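(* Let $q$ be a power of an odd prime. The density function $M_{\mathrm{rand}}$ of the random variable $-\frac{L'(1,\mathbb{X})}{L(1,\mathbb{X})}$ is positive, i.e. $M_{\mathrm{rand}}(x)>0$ for all $x\in\mathbb{R}$.
   Context: $\mathcal{M}$ and $\mathcal{P}$ are the sets of monic, respectively monic irreducible, polynomials in $\mathbb{F}_q[t]$; $N(f)=q^{\deg f}$; $\Lambda(f)=\log N(P)$ if $f=P^k$, $P\in\mathcal{P}$, $k\geq1$, and $\Lambda(f)=0$ otherwise. Let $(\mathbb{X}_P)_{P\in\mathcal{P}}$ be independent random variables with $\mathbb{P}(\mathbb{X}_P=\pm1)=\frac{N(P)}{2(N(P)+1)}$ for each sign and $\mathbb{P}(\mathbb{X}_P=0)=\frac{1}{N(P)+1}$; set $\mathbb{X}_f=\prod_{P\mid f}\mathbb{X}_P^{\mathrm{ord}_P(f)}$ for $f\in\mathcal{M}$. The random series $-\frac{L'(1,\mathbb{X})}{L(1,\mathbb{X})}:=\sum_f\frac{\Lambda(f)}{N(f)}\mathbb{X}_f$ (limit as $m\to\infty$ of the sum over $f\in\mathcal{M}$ with $\deg f\leq m$) converges almost surely. Let $F_{\mathrm{rand}}$ be its distribution function and $\Phi_{\mathrm{rand}}(u)=\mathrm{E}\left(\exp\left(iu\left(-\frac{L'(1,\mathbb{X})}{L(1,\mathbb{X})}\right)\right)\right)$ its characteristic function. $F_{\mathrm{rand}}$ has the smooth density $$M_{\mathrm{rand}}(y)=\frac{1}{2\pi}\int_{-\infty}^{\infty}\exp(-iyu)\Phi_{\mathrm{rand}}(u)\,du,\qquad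 F_{\mathrm{rand}}(x)=\int_{-\infty}^xM_{\mathrm{rand}}(y)\,dy.$$ *)

theory Defs
  imports "HOL-Probability.Probability" "HOL-Computational_Algebra.Polynomial" "HOL-Computational_Algebra.Primes"
begin

definition monic_polys :: "'a::field poly set"
  where "monic_polys = {f. lead_coeff f = 1}"

definition prime_polys :: "'a::field poly set"
  where "prime_polys = {P \<in> monic_polys. irreducible P}"

definition poly_norm :: "'a::{field, finite} poly \<Rightarrow> real"
  where "poly_norm f = real CARD('a) ^ degree f"

definition poly_mangoldt :: "'a::{field, finite} poly \<Rightarrow> real"
  where "poly_mangoldt f =
    (if \<exists>P\<in>prime_polys. \<exists>k\<ge>1. f = P ^ k
     then ln (poly_norm (THE P. P \<in> prime_polys \<and> (\<exists>k\<ge>1. f = P ^ k)))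
     else 0)"

text \<open>
  The library's \<^verbatim>\<open>multiplicity\<close> needs class instances for the coefficients that a bare \<open>field\<close>
  does not have. The set below is finite for \<open>f \<noteq> 0\<close> and irreducible \<open>P\<close>.
\<close>
definition poly_ord :: "'a::field poly \<Rightarrow> 'a poly \<Rightarrow> nat"
  where "poly_ord P f = Max {k. P ^ k dvd f}"

definition mult_ext :: "('a::field poly \<Rightarrow> 'w \<Rightarrow> real) \<Rightarrow> 'a poly \<Rightarrow> 'w \<Rightarrow> real"
  where "mult_ext X f \<omega> =
    (\<Prod>P | P \<in> prime_polys \<and> P dvd f. X P \<omega> ^ poly_ord P f)"

text \<open>
  The random variable \<open>- L'(1,X) / L(1,X)\<close>, with the series summed by increasing degree. The
  series converges only almost surely; on the exceptional null set \<^const>\<open>lim\<close> takes an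
  unspecified value, the same at all points of that set.
\<close>
definition neg_log_deriv_L ::
    "('a::{field, finite} poly \<Rightarrow> 'w \<Rightarrow> real) \<Rightarrow> 'w \<Rightarrow> real"
  where "neg_log_deriv_L X \<omega> =
    lim (\<lambda>m::nat. \<Sum>f | f \<in> monic_polys \<and> degree f \<le> m.
      poly_mangoldt f / poly_norm f * mult_ext X f \<omega>)"

definition Phi_rand ::
    "'w measure \<Rightarrow> ('a::{field, finite} poly \<Rightarrow> 'w \<Rightarrow> real) \<Rightarrow> real \<Rightarrow> complex"
  where "Phi_rand M X = char (distr M borel (neg_log_deriv_L X))"

text \<open>
  Complex-valued, as the Fourier inversion formula reads; that the values are real is not built in.
\<close>
definition M_rand ::
    "'w measure \<Rightarrow> ('a::{field, finite} poly \<Rightarrow> 'w \<Rightarrow> real) \<Rightarrow> real \<Rightarrow> complex"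
  where "M_rand M X y =
    1 / (2 * complex_of_real pi) *
      (CLBINT u. exp (- \<i> * complex_of_real (y * u)) * Phi_rand M X u)"

end

theory Submission
  imports Defs "HOL-Computational_Algebra.Polynomial_Factorial"
begin

text \<open>
  The limit \<open>Z\<close> is almost surely the sum of the independent local terms
  \<open>Y P = log N(P) * (\<Sum>k\<ge>1. (X P / N(P))^k)\<close>. Grouped by degree, these terms are absolutely summable in
  \<open>L^1\<close>, so that no appeal to Kolmogorov's theorem is needed. Let \<open>W m\<close> be the sum of the
  local terms of degree at most \<open>m\<close> and not divisible by 3. The characteristic function of
  \<open>Z - W m\<close> decays at least like \<open>1 / u^2\<close>, uniformly in \<open>m\<close>, because of the primes of degree
  divisible by 3; hence \<open>Z - W m\<close> has a density \<open>f_m \<ge> 0\<close>, and these densities converge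
  uniformly to a density \<open>f\<close>, which does not vanish at some \<open>y\<close>. As \<open>Z = W m + (Z - W m)\<close> with
  independent summands, the density of \<open>Z\<close> at \<open>x\<close> is at least \<open>Prob(W m = w) * f_m(x - w)\<close> for
  every atom \<open>w\<close> of \<open>W m\<close>. The positive and the negative values of the local terms tend to 0 and
  have divergent sums, so there are atoms \<open>w\<close> of \<open>W m\<close>, with \<open>m\<close> arbitrarily large, arbitrarily
  close to \<open>x - y\<close>.
\<close>

section \<open>Counting irreducible polynomials\<close>

text \<open>A law with full support may still have a density that vanishes at isolated points, so
  positivity at the given point needs values of a continuous density; splitting off a part with
  atoms provides them. The remainder must stay smooth while the atoms become dense, so both parts
  need infinitely many degrees. Why the modulus is 3: put y = q^j and N = q^(3j) = y^3. The crude
  bound log N <= 3 y makes the local values O(1 / y^2), so frequencies u up to order y^2 are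
  accessible, and there the decay exponent u^2 / N has order y. With modulus 2 the same bound would
  leave an exponent of order 1 and no decay. Independence of infinite sums appears as factorized
  characteristic functions, obtained as limits of finite products. Densities are handled as
  inversion integrals, as in \<open>M_rand\<close>: such an integral is a nonnegative real, is
  nonzero somewhere, and turns products of characteristic functions into averages of
  translates.\<close>

lemma monic_polysD: "f \<in> monic_polys \<Longrightarrow> f \<noteq> 0 \<and> lead_coeff f = 1"
  by (auto simp: monic_polys_def)

lemma monic_polys_mult_iff:
  fixes f g :: "'a::field poly"
  assumes "f \<in> monic_polys"
  shows "f * g \<in> monic_polys \<longleftrightarrow> g \<in> monic_polys"
  using assms by (simp add: monic_polys_def lead_coeff_mult)

lemma monic_polys_power:
  fixes f :: "'a::field poly"
  shows "f \<in> monic_polys \<Longrightarrow> f ^ k \<in> monic_polys"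
  by (simp add: monic_polys_def lead_coeff_power)

lemma monic_degree_0: "f \<in> monic_polys \<Longrightarrow> degree f = 0 \<longleftrightarrow> f = 1"
  by (auto simp: monic_polys_def elim!: degree_eq_zeroE)

lemma prime_polysD:
  fixes P :: "'a::field poly"
  assumes "P \<in> prime_polys"
  shows "P \<in> monic_polys" "irreducible P" "prime_elem P" "degree P > 0" "P \<noteq> 0" "\<not> is_unit P"
proof -
  show 1: "P \<in> monic_polys" "irreducible P" using assms by (auto simp: prime_polys_def)
  then show "prime_elem P" by (simp add: field_poly_irreducible_imp_prime)
  show "\<not> is_unit P" "P \<noteq> 0" using 1 by (auto simp: irreducible_def)
  then show "degree P > 0" using is_unit_iff_degree by blast
qed

lemma degree_prime_power:
  "P \<in> prime_polys \<Longrightarrow> degree (P ^ k) = k * degree P"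
  by (simp add: degree_power_eq prime_polysD(5))

text \<open>A divisor of least positive degree is irreducible, because a factorization into nonunits
  would give a smaller one; multiplying by the inverse of its leading coefficient makes it
  monic.\<close>

lemma ex_prime_poly_dvd:
  fixes f :: "'a::field poly"
  assumes "degree f > 0"
  shows "\<exists>P\<in>prime_polys. P dvd f"
proof -
  define P where "P = arg_min degree (\<lambda>g. degree g > 0 \<and> g dvd f)"
  have min: "degree P > 0 \<and> P dvd f" "degree g > 0 \<Longrightarrow> g dvd f \<Longrightarrow> degree P \<le> degree g" for g
    using arg_min_nat_lemma[of "\<lambda>g. degree g > 0 \<and> g dvd f" f degree] assms
    unfolding P_def by auto
  then have "P \<noteq> 0" by auto
  then have P: "P dvd f" "P \<noteq> 0" "\<not> is_unit P" using min(1) by (auto simp: is_unit_iff_degree)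
  have "irreducible P"
  proof (rule irreducibleI)
    fix a b assume ab: "P = a * b"
    then have nz: "a \<noteq> 0" "b \<noteq> 0" and dv: "a dvd f" using P by (auto intro: dvd_mult_left)
    then have "degree P = degree a + degree b" using ab by (simp add: degree_mult_eq)
    then have "degree a = 0 \<or> degree b = 0" using min(2)[OF _ dv] by linarith
    then show "is_unit a \<or> is_unit b" using nz by (simp add: is_unit_iff_degree)
  qed (use P in auto)
  note P0 = P(2) this
  let ?c = "inverse (lead_coeff P)"
  have c: "?c \<noteq> 0" using P0 by simp
  have dvd: "smult ?c P dvd f" using P(1) c by (simp add: smult_dvd_iff)
  have lc: "lead_coeff (smult ?c P) = 1" using P0 by simp
  have "is_unit [:?c:]" using c by (simp add: is_unit_const_poly_iff dvd_field_iff)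
  then have "irreducible ([:?c:] * P)" using P0 by (subst irreducible_mult_unit_left) auto
  then have "irreducible (smult ?c P)" by simp
  then have "smult ?c P \<in> prime_polys"
    unfolding prime_polys_def monic_polys_def using lc by (intro CollectI conjI)
  then show ?thesis using dvd by (rule bexI[rotated])
qed

lemma prime_polys_dvd_eq:
  fixes P Q :: "'a::field poly"
  assumes "P \<in> prime_polys" "Q \<in> prime_polys" "P dvd Q"
  shows "P = Q"
proof -
  from assms(3) obtain g where g: "Q = P * g" ..
  have gm: "g \<in> monic_polys" using g assms monic_polys_mult_iff[of P g] prime_polysD(1) by metis
  have "is_unit g" using prime_polysD(2)[OF assms(2)] prime_polysD(6)[OF assms(1)] g
    by (meson irreducibleD)
  then have "degree g = 0" using gm is_unit_iff_degree monic_polysD by blast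
  then have "g = 1" using gm monic_degree_0 by blast
  then show ?thesis using g by simp
qed

text \<open>A prime of multiplicity m in a nonzero \<open>f\<close> contributes exactly the pairs
  with exponents 1 to m, so summing over this set counts primes with multiplicity.\<close>

definition prime_power_divs :: "'a::field poly \<Rightarrow> ('a poly \<times> nat) set"
  where "prime_power_divs f = {(P, j). P \<in> prime_polys \<and> j \<ge> 1 \<and> P ^ j dvd f}"

text \<open>The factor \<open>Q\<close> raises its own multiplicity by one and leaves the others
  unchanged, since no other prime divides \<open>Q\<close>. So exactly one pair is new, its exponent
  being one more than the multiplicity of \<open>Q\<close> in \<open>g\<close>.\<close>

lemma prime_power_divs_mult:
  fixes Q g :: "'a::field poly"
  assumes Q: "Q \<in> prime_polys" and g: "g \<noteq> 0"
  shows "\<exists>m. prime_power_divs (Q * g) = insert (Q, m) (prime_power_divs g) \<and> (Q, m) \<notin> prime_power_divs g"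
proof -
  define K where "K = {k. Q ^ k dvd g}"
  have bd: "k \<le> degree g" if "k \<in> K" for k
  proof -
    have "k * degree Q \<le> degree g"
      using that g Q dvd_imp_degree_le[of "Q ^ k" g] by (simp add: K_def degree_prime_power)
    moreover have "k \<le> k * degree Q" using prime_polysD(4)[OF Q] by simp
    ultimately show ?thesis by linarith
  qed
  have fin: "finite K" using bd finite_nat_set_iff_bounded_le by blast
  have K0: "0 \<in> K" by (simp add: K_def)
  define m where "m = Max K"
  have mK: "m \<in> K" unfolding m_def using fin K0 by (intro Max_in) auto
  have K_iff: "k \<in> K \<longleftrightarrow> k \<le> m" for k
    using mK Max_ge[OF fin, of k] dvd_trans[OF le_imp_power_dvd[of k m Q]]
    unfolding m_def[symmetric] by (auto simp: K_def)
  have eq: "(P, j) \<in> prime_power_divs (Q * g) \<longleftrightarrow> (P, j) = (Q, Suc m) \<or> (P, j) \<in> prime_power_divs g" for P j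
  proof (cases "P \<in> prime_polys \<and> j \<ge> 1")
    case True
    show ?thesis
    proof (cases "P = Q")
      case PQ: True
      obtain i where i: "j = Suc i" using True by (cases j) auto
      have "P ^ j dvd Q * g \<longleftrightarrow> i \<in> K" using PQ i prime_polysD(5)[OF Q] by (simp add: K_def)
      moreover have "P ^ j dvd g \<longleftrightarrow> j \<in> K" using PQ by (simp add: K_def)
      ultimately show ?thesis using True PQ i by (auto simp: prime_power_divs_def K_iff)
    next
      case False
      have "\<not> P dvd Q" using False True Q prime_polys_dvd_eq by blast
      then have "P ^ j dvd Q * g \<longleftrightarrow> P ^ j dvd g"
        using True prime_power_dvd_multD[of P j Q g] prime_polysD(3)[of P] by auto
      then show ?thesis using False by (auto simp: prime_power_divs_def)
    qed
  next
    case False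
    then show ?thesis using Q by (auto simp: prime_power_divs_def)
  qed
  have "(Q, Suc m) \<notin> prime_power_divs g"
    using K_iff[of "Suc m"] by (auto simp: prime_power_divs_def K_def)
  then show ?thesis using eq by (intro exI[of _ "Suc m"]) auto
qed

text \<open>Up to the factor log q this is the identity that log N(f) is the sum of Lambda over the
  divisors of f. Splitting off a prime factor \<open>Q\<close> removes one pair and lowers both
  sides by \<open>degree Q\<close>.\<close>

lemma degree_eq_sum_prime_power_divs:
  fixes f :: "'a::field poly"
  assumes "f \<in> monic_polys"
  shows "finite (prime_power_divs f) \<and> (\<Sum>(P, j)\<in>prime_power_divs f. degree P) = degree f"
  using assms
proof (induction "degree f" arbitrary: f rule: less_induct)
  case less
  show ?case
  proof (cases "degree f = 0")
    case True
    then have "f = 1" using less monic_degree_0 by blast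
    moreover have "\<not> P ^ j dvd 1" if "P \<in> prime_polys" "j \<ge> 1" for P :: "'a poly" and j
      using that prime_polysD(6)[of P] by (auto simp: is_unit_power_iff)
    ultimately have "prime_power_divs f = {}" by (auto simp: prime_power_divs_def)
    then show ?thesis using True by simp
  next
    case False
    then obtain Q where Q: "Q \<in> prime_polys" "Q dvd f" using ex_prime_poly_dvd by blast
    then obtain g where g: "f = Q * g" by (elim dvdE)
    have gm: "g \<in> monic_polys" using g Q less(2) monic_polys_mult_iff prime_polysD(1) by blast
    then have g0: "g \<noteq> 0" using monic_polysD by blast
    have deg: "degree f = degree Q + degree g"
      using g g0 prime_polysD(5)[OF Q(1)] by (simp add: degree_mult_eq)
    then have "degree g < degree f" using prime_polysD(4)[OF Q(1)] by simp
    from less(1)[OF this gm] obtain m where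
      "prime_power_divs f = insert (Q, m) (prime_power_divs g)" "(Q, m) \<notin> prime_power_divs g"
      "finite (prime_power_divs g)" "(\<Sum>(P, j)\<in>prime_power_divs g. degree P) = degree g"
      using prime_power_divs_mult[OF Q(1) g0] g by auto
    then show ?thesis using deg by simp
  qed
qed

section \<open>The numbers of monic and of prime polynomials of a given degree\<close>

lemma card_monic_polys_degree:
  "finite {f \<in> monic_polys :: 'a::{field,finite} poly set. degree f = n}"
  "card {f \<in> monic_polys :: 'a::{field,finite} poly set. degree f = n} = CARD('a) ^ n"
proof -
  let ?L = "{xs :: 'a list. set xs \<subseteq> UNIV \<and> length xs = n}"
  let ?h = "\<lambda>xs :: 'a list. Poly (xs @ [1])"
  have co: "coeff (?h xs) i = (if i < n then xs ! i else if i = n then 1 else 0)" if "length xs = n" for xs i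
    using that by (auto simp: nth_default_append nth_default_Cons split: nat.split)
  have deg: "degree (?h xs) = n" if "length xs = n" for xs
  proof (rule antisym)
    show "degree (?h xs) \<le> n" by (rule degree_le) (simp add: co[OF that] del: coeff_Poly_eq)
    show "n \<le> degree (?h xs)" by (rule le_degree) (simp add: co[OF that] del: coeff_Poly_eq)
  qed
  have bij: "bij_betw ?h ?L {f \<in> monic_polys. degree f = n}"
  proof (rule bij_betwI')
    fix xs ys assume L: "xs \<in> ?L" "ys \<in> ?L"
    show "(?h xs = ?h ys) = (xs = ys)"
    proof
      assume "?h xs = ?h ys"
      then have "coeff (?h xs) i = coeff (?h ys) i" for i by simp
      then have "xs ! i = ys ! i" if "i < n" for i using that L co[of xs i] co[of ys i] by simp
      then show "xs = ys" using L by (intro nth_equalityI) auto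
    qed simp
  next
    fix xs assume L: "xs \<in> ?L"
    then have "degree (?h xs) = n" using deg by simp
    then show "?h xs \<in> {f \<in> monic_polys. degree f = n}"
      using L co[of xs n] by (simp add: monic_polys_def)
  next
    fix f :: "'a poly" assume f: "f \<in> {f \<in> monic_polys. degree f = n}"
    let ?xs = "map (coeff f) [0..<n]"
    have "f = ?h ?xs"
    proof (rule poly_eqI)
      fix i show "coeff f i = coeff (?h ?xs) i"
        using f by (subst co) (auto simp: monic_polys_def coeff_eq_0)
    qed
    then show "\<exists>xs\<in>?L. f = ?h xs" by (intro bexI[of _ ?xs]) auto
  qed
  have "finite ?L" "card ?L = CARD('a) ^ n"
    using finite_lists_length_eq[of "UNIV :: 'a set" n] card_lists_length_eq[of "UNIV :: 'a set" n] by auto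
  then show "finite {f \<in> monic_polys :: 'a poly set. degree f = n}"
    "card {f \<in> monic_polys :: 'a poly set. degree f = n} = CARD('a) ^ n"
    using bij_betw_finite[OF bij] bij_betw_same_card[OF bij] by auto
qed

lemma finite_monic_le: "finite {f \<in> monic_polys :: 'a::{field,finite} poly set. degree f \<le> n}"
proof -
  have "{f \<in> monic_polys :: 'a poly set. degree f \<le> n} = (\<Union>k\<le>n. {f \<in> monic_polys. degree f = k})" by auto
  then show ?thesis by (simp add: card_monic_polys_degree(1))
qed

definition prime_polys_deg :: "nat \<Rightarrow> 'a::field poly set"
  where "prime_polys_deg d = {P \<in> prime_polys. degree P = d}"

lemma prime_polys_deg_subset: "prime_polys_deg d \<subseteq> {f \<in> monic_polys. degree f = d}"
  by (auto simp: prime_polys_deg_def prime_polys_def)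

lemma finite_prime_polys_deg: "finite (prime_polys_deg d :: 'a::{field,finite} poly set)"
  using finite_subset[OF prime_polys_deg_subset card_monic_polys_degree(1)] .

definition prime_powers_deg :: "nat \<Rightarrow> ('a::field poly \<times> nat) set"
  where "prime_powers_deg n = {(P, j). P \<in> prime_polys \<and> j \<ge> 1 \<and> j * degree P = n}"

lemma finite_prime_powers_deg: "finite (prime_powers_deg n :: ('a::{field,finite} poly \<times> nat) set)"
proof (cases "n = 0")
  case True
  then have "prime_powers_deg n = ({} :: ('a poly \<times> nat) set)"
    using prime_polysD(4) by (fastforce simp: prime_powers_deg_def)
  then show ?thesis by simp
next
  case False
  have "prime_powers_deg n \<subseteq> {f \<in> monic_polys :: 'a poly set. degree f \<le> n} \<times> {..n}"
    using False by (auto simp: prime_powers_deg_def prime_polys_def)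
  then show ?thesis using finite_monic_le finite_subset by blast
qed

lemma card_monic_multiples:
  fixes R :: "'a::{field,finite} poly"
  assumes R: "R \<in> monic_polys" "degree R \<le> n"
  shows "card {f \<in> monic_polys. degree f = n \<and> R dvd f} = CARD('a) ^ (n - degree R)"
proof -
  have "bij_betw (\<lambda>g. R * g) {g \<in> monic_polys :: 'a poly set. degree g = n - degree R} {f \<in> monic_polys. degree f = n \<and> R dvd f}"
  proof (rule bij_betwI')
    fix g h :: "'a poly" show "(R * g = R * h) = (g = h)" using R monic_polysD by auto
  next
    fix g :: "'a poly" assume "g \<in> {g \<in> monic_polys. degree g = n - degree R}"
    then show "R * g \<in> {f \<in> monic_polys. degree f = n \<and> R dvd f}"
      using R monic_polysD[of g] monic_polysD[of R] by (auto simp: monic_polys_mult_iff degree_mult_eq)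
  next
    fix f assume f: "f \<in> {f \<in> monic_polys. degree f = n \<and> R dvd f}"
    then obtain g where g: "f = R * g" by auto
    then have "g \<in> monic_polys" using R f monic_polys_mult_iff by auto
    moreover have "degree g = n - degree R"
      using f g R monic_polysD[of R] monic_polysD[OF calculation] by (auto simp: degree_mult_eq)
    ultimately show "\<exists>g\<in>{g \<in> monic_polys. degree g = n - degree R}. f = R * g" using g by auto
  qed
  from bij_betw_same_card[OF this] show ?thesis by (simp add: card_monic_polys_degree(2))
qed

text \<open>
  Sum the degrees of all monic polynomials of degree \<open>n\<close>, each written as the sum of the degrees of its
  prime power divisors, and compare \<open>n\<close> with \<open>n - 1\<close>.
\<close>
lemma sum_degree_prime_powers_deg:
  assumes "n \<ge> 1"
  shows "(\<Sum>(P, j)\<in>prime_powers_deg n. degree (P :: 'a::{field,finite} poly)) = CARD('a) ^ n"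
proof -
  let ?q = "CARD('a)"
  let ?s = "\<lambda>k. \<Sum>(P, j)\<in>prime_powers_deg k. degree (P :: 'a poly)"
  have main: "(\<Sum>k\<le>n. ?s k * ?q ^ (n - k)) = n * ?q ^ n" for n
  proof -
    let ?M = "{f \<in> monic_polys :: 'a poly set. degree f = n}"
    let ?D = "\<Union>k\<le>n. prime_powers_deg k :: ('a poly \<times> nat) set"
    have finD: "finite ?D" using finite_prime_powers_deg by auto
    have sub: "prime_power_divs f = {x \<in> ?D. fst x ^ snd x dvd f}" if "f \<in> ?M" for f
    proof -
      have "j * degree P \<le> n" if "P \<in> prime_polys" "P ^ j dvd f" for P j
        using that \<open>f \<in> ?M\<close> dvd_imp_degree_le[of "P ^ j" f] monic_polysD[of f]
        by (auto simp: degree_prime_power)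
      then show ?thesis by (auto simp: prime_power_divs_def prime_powers_deg_def)
    qed
    have "n * ?q ^ n = (\<Sum>f\<in>?M. degree f)" by (simp add: card_monic_polys_degree(2))
    also have "\<dots> = (\<Sum>f\<in>?M. \<Sum>x\<in>{x \<in> ?D. fst x ^ snd x dvd f}. degree (fst x))"
    proof (rule sum.cong[OF refl])
      fix f assume "f \<in> ?M"
      then show "degree f = (\<Sum>x\<in>{x \<in> ?D. fst x ^ snd x dvd f}. degree (fst x))"
        using degree_eq_sum_prime_power_divs[of f] sub[of f] by (simp add: case_prod_unfold)
    qed
    also have "\<dots> = (\<Sum>x\<in>?D. \<Sum>f\<in>{f \<in> ?M. fst x ^ snd x dvd f}. degree (fst x))"
      using finD card_monic_polys_degree(1) by (rule sum.swap_restrict[symmetric])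
    also have "\<dots> = (\<Sum>x\<in>?D. degree (fst x) * ?q ^ (n - snd x * degree (fst x)))"
    proof (rule sum.cong[OF refl])
      fix x assume x: "x \<in> ?D"
      then have "fst x \<in> prime_polys" "snd x * degree (fst x) \<le> n"
        by (auto simp: prime_powers_deg_def case_prod_unfold)
      then have "card {f \<in> monic_polys. degree f = n \<and> fst x ^ snd x dvd f} = ?q ^ (n - snd x * degree (fst x))"
        using card_monic_multiples[of "fst x ^ snd x" n]
        by (simp add: prime_polysD(1) monic_polys_power degree_prime_power)
      then show "(\<Sum>f\<in>{f \<in> ?M. fst x ^ snd x dvd f}. degree (fst x)) = degree (fst x) * ?q ^ (n - snd x * degree (fst x))"
        by (simp add: conj_ac)
    qed
    also have "\<dots> = (\<Sum>k\<le>n. \<Sum>x\<in>prime_powers_deg k. degree (fst x :: 'a poly) * ?q ^ (n - snd x * degree (fst x)))"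
    proof (rule sum.UNION_disjoint)
      show "\<forall>i\<in>{..n}. \<forall>j\<in>{..n}. i \<noteq> j \<longrightarrow> prime_powers_deg i \<inter> (prime_powers_deg j :: ('a poly \<times> nat) set) = {}"
        unfolding prime_powers_deg_def by fastforce
    qed (simp_all add: finite_prime_powers_deg)
    also have "\<dots> = (\<Sum>k\<le>n. ?s k * ?q ^ (n - k))"
    proof (rule sum.cong[OF refl])
      fix k
      have "(\<Sum>x\<in>prime_powers_deg k. degree (fst x :: 'a poly) * ?q ^ (n - snd x * degree (fst x)))
          = (\<Sum>x\<in>prime_powers_deg k. degree (fst x :: 'a poly) * ?q ^ (n - k))"
      proof (rule sum.cong[OF refl])
        fix x :: "'a poly \<times> nat" assume "x \<in> prime_powers_deg k"
        then have "snd x * degree (fst x) = k" unfolding prime_powers_deg_def by force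
        then show "degree (fst x) * ?q ^ (n - snd x * degree (fst x)) = degree (fst x) * ?q ^ (n - k)" by simp
      qed
      then show "(\<Sum>x\<in>prime_powers_deg k. degree (fst x :: 'a poly) * ?q ^ (n - snd x * degree (fst x))) = ?s k * ?q ^ (n - k)"
        by (simp add: sum_distrib_right case_prod_unfold)
    qed
    finally show ?thesis by simp
  qed
  obtain m where m: "n = Suc m" using assms by (cases n) auto
  \<comment> \<open>Apart from its last term, the sum for m + 1 is q times the sum for m. Hence
    \<open>?s (Suc m)\<close> is (m + 1) q^(m + 1) - q * m q^m = q^(m + 1).\<close>
  have "(\<Sum>k\<le>Suc m. ?s k * ?q ^ (Suc m - k)) = ?s (Suc m) + ?q * (\<Sum>k\<le>m. ?s k * ?q ^ (m - k))"
    by (simp add: sum_distrib_left Suc_diff_le mult_ac)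
  then show ?thesis using main[of "Suc m"] main[of m] m by simp
qed

text \<open>Only the pairs with exponent 1 are kept from
  \<open>sum_degree_prime_powers_deg\<close>.\<close>

lemma prime_polys_deg_upper:
  assumes "d \<ge> 1"
  shows "d * card (prime_polys_deg d :: 'a::{field,finite} poly set) \<le> CARD('a) ^ d"
proof -
  have "d * card (prime_polys_deg d :: 'a poly set) = (\<Sum>x\<in>(\<lambda>P :: 'a poly. (P, 1::nat)) ` prime_polys_deg d. degree (fst x))"
    by (subst sum.reindex) (auto simp: prime_polys_deg_def inj_on_def)
  also have "\<dots> \<le> (\<Sum>x\<in>prime_powers_deg d. degree (fst x :: 'a poly))"
    using finite_prime_powers_deg by (intro sum_mono2) (auto simp: prime_polys_deg_def prime_powers_deg_def)
  also have "\<dots> = CARD('a) ^ d" using sum_degree_prime_powers_deg[OF assms] by (simp add: case_prod_unfold)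
  finally show ?thesis .
qed

text \<open>In the identity for degree \<open>d\<close>, the primes of degree e < d contribute at
  most q^e each by the upper bound, and these powers add up to at most q^d / 2 because q is at least
  3. The other half of q^d is left for the primes of degree \<open>d\<close>.\<close>

lemma prime_polys_deg_lower:
  assumes d: "d \<ge> 1" and q: "CARD('a::{field,finite}) \<ge> 3"
  shows "CARD('a) ^ d \<le> 2 * d * card (prime_polys_deg d :: 'a poly set)"
proof -
  let ?q = "CARD('a)"
  \<comment> \<open>When e divides \<open>d\<close>, \<open>d div e\<close> is the only possible
    exponent. The other e merely enlarge the union, which is harmless for an upper bound.\<close>
  let ?A = "\<lambda>e. (\<lambda>P :: 'a poly. (P, d div e)) ` prime_polys_deg e"
  have "prime_powers_deg d \<subseteq> (\<Union>e\<in>{1..d}. ?A e)"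
  proof
    fix x :: "'a poly \<times> nat" assume "x \<in> prime_powers_deg d"
    then obtain P j where x: "x = (P, j)" "P \<in> prime_polys" "d = j * degree P" "1 \<le> j"
      unfolding prime_powers_deg_def by blast
    have pos: "degree P > 0" using prime_polysD(4)[OF x(2)] .
    have "P \<in> prime_polys_deg (degree P)" using x by (simp add: prime_polys_deg_def)
    moreover have "x = (P, d div degree P)" using x(1,3) pos by simp
    ultimately have "x \<in> ?A (degree P)" by blast
    moreover have "degree P \<in> {1..d}" using x(3,4) pos by simp
    ultimately show "x \<in> (\<Union>e\<in>{1..d}. ?A e)" by blast
  qed
  then have "(\<Sum>x\<in>prime_powers_deg d. degree (fst x :: 'a poly)) \<le> (\<Sum>x\<in>(\<Union>e\<in>{1..d}. ?A e). degree (fst x))"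
    using finite_prime_polys_deg by (intro sum_mono2) auto
  also have "\<dots> = (\<Sum>e\<in>{1..d}. \<Sum>x\<in>?A e. degree (fst x))"
    using finite_prime_polys_deg by (intro sum.UNION_disjoint) (auto simp: prime_polys_deg_def)
  also have "\<dots> = (\<Sum>e\<in>{1..d}. e * card (prime_polys_deg e :: 'a poly set))"
    by (intro sum.cong refl, subst sum.reindex) (auto simp: prime_polys_deg_def inj_on_def)
  also have "\<dots> = d * card (prime_polys_deg d :: 'a poly set) + (\<Sum>e\<in>{1..<d}. e * card (prime_polys_deg e :: 'a poly set))"
    using d by (simp add: atLeastLessThanSuc_atLeastAtMost[symmetric])
  also have "\<dots> \<le> d * card (prime_polys_deg d :: 'a poly set) + (\<Sum>e\<in>{1..<d}. ?q ^ e)"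
    by (intro add_mono sum_mono prime_polys_deg_upper) auto
  finally have 1: "?q ^ d \<le> d * card (prime_polys_deg d :: 'a poly set) + (\<Sum>e\<in>{1..<d}. ?q ^ e)"
    using sum_degree_prime_powers_deg[OF d, where 'a='a] by (simp add: case_prod_unfold)
  have "2 * (\<Sum>e\<in>{1..<d}. ?q ^ e) \<le> ?q ^ d"
  proof (induction d)
    case (Suc d)
    have "3 * ?q ^ d \<le> ?q * ?q ^ d" using q by (rule mult_right_mono) simp
    moreover have "(\<Sum>e\<in>{1..<Suc d}. ?q ^ e) \<le> (\<Sum>e\<in>{1..<d}. ?q ^ e) + ?q ^ d"
      by (simp add: atLeastLessThanSuc)
    ultimately show ?case using Suc unfolding power_Suc by linarith
  qed simp
  with 1 show ?thesis by linarith
qed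

section \<open>Densities of distributions with integrable characteristic function\<close>

text \<open>The inversion integral of \<open>M_rand\<close> for an arbitrary law, so that
  \<open>Z\<close> and the remainders \<open>Z - W m\<close> are treated alike.\<close>

definition char_density :: "real measure \<Rightarrow> real \<Rightarrow> complex"
  where "char_density \<mu> x =
    1 / (2 * complex_of_real pi) * (CLBINT u. exp (- \<i> * complex_of_real (x * u)) * char \<mu> u)"

text \<open>Fubini moves the Fourier transform from the measure to \<open>g\<close>. With a Gaussian
  factor in \<open>g\<close> this regularizes the inversion integral; with another characteristic
  function in \<open>g\<close> it computes the density of a convolution.\<close>

lemma (in real_distribution) integral_mult_char:
  fixes g :: "real \<Rightarrow> complex"
  assumes g: "integrable lborel g"
  shows "(CLBINT u. g u * char M u) = (CLINT z|M. (CLBINT u. g u * iexp (u * z)))"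
proof -
  interpret P: pair_sigma_finite lborel M ..
  have [measurable]: "g \<in> borel_measurable borel" using g by simp
  have "(CLBINT u. g u * char M u) = (CLBINT u. (CLINT z|M. g u * iexp (u * z)))"
    unfolding char_def by simp
  also have "\<dots> = (CLINT z|M. (CLBINT u. g u * iexp (u * z)))"
  proof (rule P.Fubini_integral[symmetric])
    show "integrable (lborel \<Otimes>\<^sub>M M) (\<lambda>(u, z). g u * iexp (u * z))"
    proof (rule P.Fubini_integrable)
      show "integrable lborel (\<lambda>u. LINT z|M. cmod (case (u, z) of (u, z) \<Rightarrow> g u * iexp (u * z)))"
        using g by (simp add: norm_mult prob_space)
      show "AE u in lborel. integrable M (\<lambda>z. case (u, z) of (u, z) \<Rightarrow> g u * iexp (u * z))"
        by (auto intro!: integrable_mult_right integrable_const_bound[where B=1])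
    qed measurable
  qed
  finally show ?thesis .
qed

lemma gaussian_fourier:
  fixes t \<sigma> :: real
  assumes "\<sigma> > 0"
  shows "(CLBINT u. complex_of_real (exp (- (\<sigma> * u)\<^sup>2 / 2)) * iexp (u * t))
    = complex_of_real (sqrt (2 * pi) / \<sigma> * exp (- (t / \<sigma>)\<^sup>2 / 2))"
proof -
  have 1: "(CLBINT v. complex_of_real (exp (- v\<^sup>2 / 2)) * iexp (v * s)) = complex_of_real (sqrt (2 * pi) * exp (- s\<^sup>2 / 2))" for s
  proof -
    have "complex_of_real (exp (- s\<^sup>2 / 2)) = char std_normal_distribution s"
      by (simp add: char_std_normal_distribution)
    also have "\<dots> = (CLBINT v. std_normal_density v *\<^sub>R iexp (s * v))"
      unfolding char_def by (subst integral_density) auto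
    also have "\<dots> = (CLBINT v. complex_of_real (1 / sqrt (2 * pi)) * (complex_of_real (exp (- v\<^sup>2 / 2)) * iexp (v * s)))"
      by (intro Bochner_Integration.integral_cong)
         (simp_all add: std_normal_density_def scaleR_conv_of_real mult_ac)
    also have "\<dots> = complex_of_real (1 / sqrt (2 * pi)) * (CLBINT v. (complex_of_real (exp (- v\<^sup>2 / 2)) * iexp (v * s)))"
      by (rule integral_mult_right_zero)
    finally show ?thesis by (simp add: field_simps)
  qed
  have "(CLBINT v. complex_of_real (exp (- v\<^sup>2 / 2)) * iexp (v * (t / \<sigma>)))
      = \<bar>\<sigma>\<bar> *\<^sub>R (CLBINT u. complex_of_real (exp (- (0 + \<sigma> * u)\<^sup>2 / 2)) * iexp ((0 + \<sigma> * u) * (t / \<sigma>)))"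
    using assms by (intro lborel_integral_real_affine) simp
  also have "\<dots> = \<sigma> *\<^sub>R (CLBINT u. complex_of_real (exp (- (\<sigma> * u)\<^sup>2 / 2)) * iexp (u * t))"
    using assms by simp
  finally show ?thesis using assms unfolding 1 by (simp add: field_simps scaleR_conv_of_real)
qed

lemma gaussian_integrable:
  fixes \<sigma> :: real
  assumes "\<sigma> > 0"
  shows "integrable lborel (\<lambda>u. exp (- (\<sigma> * u)\<^sup>2 / 2))"
proof -
  have "integrable lborel (\<lambda>u. (sqrt (2 * pi) / \<sigma>) * normal_density 0 (1 / \<sigma>) u)"
    using assms by (intro integrable_mult_right integrable_normal_density) auto
  also have "(\<lambda>u. (sqrt (2 * pi) / \<sigma>) * normal_density 0 (1 / \<sigma>) u) = (\<lambda>u. exp (- (\<sigma> * u)\<^sup>2 / 2))"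
    using assms by (auto simp: normal_density_def fun_eq_iff field_simps real_sqrt_mult real_sqrt_divide)
  finally show ?thesis .
qed

text \<open>Gaussian damping turns the inversion integral at \<open>x\<close> into a positive
  multiple of a Gaussian average of the distribution around \<open>x\<close>. It serves with
  \<sigma> tending to 0 for nonnegativity, and with \<sigma> = 1 at the origin for
  nonvanishing.\<close>

lemma (in real_distribution) gaussian_smoothing:
  fixes x \<sigma> :: real
  assumes \<sigma>: "\<sigma> > 0"
  shows "(CLBINT u. exp (- \<i> * complex_of_real (x * u)) * complex_of_real (exp (- (\<sigma> * u)\<^sup>2 / 2)) * char M u)
    = complex_of_real (sqrt (2 * pi) / \<sigma> * (LINT z|M. exp (- ((z - x) / \<sigma>)\<^sup>2 / 2)))"
proof -
  let ?g = "\<lambda>u. exp (- \<i> * complex_of_real (x * u)) * complex_of_real (exp (- (\<sigma> * u)\<^sup>2 / 2))"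
  have "integrable lborel ?g"
    by (rule Bochner_Integration.integrable_bound[OF gaussian_integrable[OF \<sigma>]])
       (auto simp: norm_mult)
  then have "(CLBINT u. ?g u * char M u) = (CLINT z|M. (CLBINT u. ?g u * iexp (u * z)))"
    by (rule integral_mult_char)
  also have "\<dots> = (CLINT z|M. (CLBINT u. complex_of_real (exp (- (\<sigma> * u)\<^sup>2 / 2)) * iexp (u * (z - x))))"
    by (intro Bochner_Integration.integral_cong refl)
       (simp add: exp_add[symmetric] exp_minus algebra_simps exp_diff divide_simps)
  also have "\<dots> = (CLINT z|M. complex_of_real (sqrt (2 * pi) / \<sigma> * exp (- ((z - x) / \<sigma>)\<^sup>2 / 2)))"
    by (simp only: gaussian_fourier[OF \<sigma>])
  also have "\<dots> = complex_of_real (LINT z|M. sqrt (2 * pi) / \<sigma> * exp (- ((z - x) / \<sigma>)\<^sup>2 / 2))"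
    by (rule integral_complex_of_real)
  also have "\<dots> = complex_of_real (sqrt (2 * pi) / \<sigma> * (LINT z|M. exp (- ((z - x) / \<sigma>)\<^sup>2 / 2)))"
    by (subst integral_mult_right_zero) simp
  finally show ?thesis .
qed

text \<open>The damped integrals are nonnegative reals by \<open>gaussian_smoothing\<close>. As the
  damping is removed they tend to the inversion integral, dominated by
  \<open>cmod (char M u)\<close>.\<close>

lemma (in real_distribution) char_density_nonneg:
  assumes int: "integrable lborel (char M)"
  shows "char_density M x \<in> \<real> \<and> Re (char_density M x) \<ge> 0"
proof -
  let ?I = "CLBINT u. exp (- \<i> * complex_of_real (x * u)) * char M u"
  let ?\<sigma> = "\<lambda>n. inverse (real (Suc n))"
  let ?J = "\<lambda>n. CLBINT u. exp (- \<i> * complex_of_real (x * u)) * complex_of_real (exp (- (?\<sigma> n * u)\<^sup>2 / 2)) * char M u"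
  have lim: "?J \<longlonglongrightarrow> ?I"
  proof (rule integral_dominated_convergence[where w="\<lambda>u. cmod (char M u)"])
    show "integrable lborel (\<lambda>u. cmod (char M u))" using int by simp
    show "AE u in lborel. (\<lambda>n. exp (- \<i> * complex_of_real (x * u)) * complex_of_real (exp (- (?\<sigma> n * u)\<^sup>2 / 2)) * char M u)
        \<longlonglongrightarrow> exp (- \<i> * complex_of_real (x * u)) * char M u"
    proof (rule AE_I2)
      fix u
      have "(\<lambda>n. exp (- \<i> * complex_of_real (x * u)) * complex_of_real (exp (- (?\<sigma> n * u)\<^sup>2 / 2)) * char M u)
        \<longlonglongrightarrow> exp (- \<i> * complex_of_real (x * u)) * complex_of_real (exp (- (0 * u)\<^sup>2 / 2)) * char M u"
        by (intro tendsto_intros LIMSEQ_inverse_real_of_nat) auto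
      then show "(\<lambda>n. exp (- \<i> * complex_of_real (x * u)) * complex_of_real (exp (- (?\<sigma> n * u)\<^sup>2 / 2)) * char M u)
        \<longlonglongrightarrow> exp (- \<i> * complex_of_real (x * u)) * char M u" by simp
    qed
  qed (auto simp: norm_mult mult_left_le_one_le intro!: mult_left_le_one_le)
  have J: "?J n \<in> \<real> \<and> Re (?J n) \<ge> 0" for n
    using gaussian_smoothing[of "?\<sigma> n" x] by (auto simp: Bochner_Integration.integral_nonneg)
  have "?I \<in> \<real>" "Re ?I \<ge> 0"
  proof -
    show "?I \<in> \<real>" by (rule closed_sequentially[OF closed_complex_Reals _ lim]) (use J in blast)
    show "Re ?I \<ge> 0" by (rule LIMSEQ_le_const[OF tendsto_Re[OF lim]]) (use J in blast)
  qed
  then show ?thesis unfolding char_density_def by (auto elim!: Reals_cases)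
qed

text \<open>
  If the density vanished identically, pairing it with a Gaussian would give 0, whereas the Gaussian
  average of the distribution is positive.
\<close>
lemma (in real_distribution) char_density_nonzero:
  assumes int: "integrable lborel (char M)"
  shows "\<exists>x. char_density M x \<noteq> 0"
proof (rule ccontr)
  assume "\<not> ?thesis"
  then have 0: "(CLBINT u. exp (- \<i> * complex_of_real (x * u)) * char M u) = 0" for x
    by (auto simp: char_density_def)
  interpret N: real_distribution std_normal_distribution
    by (rule real_dist_normal_dist)
  have "(CLBINT u. char M u * char std_normal_distribution u)
      = (CLINT z|std_normal_distribution. (CLBINT u. char M u * iexp (u * z)))"
    using int by (rule N.integral_mult_char)
  also have "(\<lambda>z. CLBINT u. char M u * iexp (u * z)) = (\<lambda>z. 0)"
  proof
    fix z show "(CLBINT u. char M u * iexp (u * z)) = 0" using 0[of "-z"] by (simp add: mult_ac)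
  qed
  finally have "(CLBINT u. char M u * char std_normal_distribution u) = 0" by simp
  moreover have "(CLBINT u. char M u * char std_normal_distribution u)
      = complex_of_real (sqrt (2 * pi) / 1 * (LINT z|M. exp (- ((z - 0) / 1)\<^sup>2 / 2)))"
    by (subst gaussian_smoothing[symmetric]) (simp_all add: char_std_normal_distribution mult_ac)
  ultimately have "(LINT z|M. exp (- z\<^sup>2 / 2)) = 0" by simp
  moreover have "integrable M (\<lambda>z. exp (- z\<^sup>2 / 2))"
    by (rule integrable_const_bound[where B=1]) auto
  ultimately have "AE z in M. exp (- z\<^sup>2 / 2) = (0::real)"
    by (subst (asm) integral_nonneg_eq_0_iff_AE) auto
  then show False by simp
qed

lemma integrable_iexp_mult:
  assumes "integrable lborel f"
  shows "integrable lborel (\<lambda>u. exp (- \<i> * complex_of_real (x * u)) * f u)"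
  by (rule Bochner_Integration.integrable_bound[OF assms]) (use assms in \<open>auto simp: norm_mult\<close>)

text \<open>Independence is expressed by factorized characteristic functions because this form
  survives the limit from finite sums of blocks. The conclusion is the convolution formula for
  densities.\<close>

lemma char_density_mult:
  assumes "real_distribution \<nu>" "real_distribution \<rho>"
    and int: "integrable lborel (char \<rho>)"
    and char: "\<And>u. char \<mu> u = char \<nu> u * char \<rho> u"
  shows "char_density \<mu> x = (CLINT w|\<nu>. char_density \<rho> (x - w))"
proof -
  interpret N: real_distribution \<nu> by fact
  have "(CLBINT u. exp (- \<i> * complex_of_real (x * u)) * char \<mu> u)
      = (CLBINT u. (exp (- \<i> * complex_of_real (x * u)) * char \<rho> u) * char \<nu> u)"
    by (simp add: char mult_ac)
  also have "\<dots> = (CLINT w|\<nu>. (CLBINT u. (exp (- \<i> * complex_of_real (x * u)) * char \<rho> u) * iexp (u * w)))"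
    by (rule N.integral_mult_char) (rule integrable_iexp_mult[OF int])
  also have "\<dots> = (CLINT w|\<nu>. (CLBINT u. exp (- \<i> * complex_of_real ((x - w) * u)) * char \<rho> u))"
    by (intro Bochner_Integration.integral_cong refl)
       (simp add: exp_add[symmetric] exp_minus algebra_simps exp_diff divide_simps)
  finally show ?thesis unfolding char_density_def by simp
qed

text \<open>The average in \<open>char_density_mult\<close> has a nonnegative integrand, so it is at
  least its part at the atom, which is \<open>measure \<nu> {w}\<close> times the density of \<rho>
  at \<open>x - w\<close>. The vanishing form serves a later proof by contradiction.\<close>

lemma char_density_atom:
  assumes \<nu>: "real_distribution \<nu>" and \<rho>: "real_distribution \<rho>"
    and int: "integrable lborel (char \<rho>)"
    and char: "\<And>u. char \<mu> u = char \<nu> u * char \<rho> u"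
    and pos: "measure \<nu> {w} > 0" and le: "Re (char_density \<mu> x) \<le> 0"
  shows "char_density \<rho> (x - w) = 0"
proof -
  interpret N: real_distribution \<nu> by fact
  interpret R: real_distribution \<rho> by fact
  let ?f = "\<lambda>w. char_density \<rho> (x - w)"
  have nn: "?f v \<in> \<real> \<and> Re (?f v) \<ge> 0" for v by (rule R.char_density_nonneg[OF int])
  have [measurable]: "?f \<in> borel_measurable borel"
    unfolding char_density_def by measurable
  \<comment> \<open>A bound uniform in \<open>v\<close> makes the translates integrable against the
    probability measure \<nu>.\<close>
  have bd: "cmod (?f v) \<le> 1 / (2 * pi) * (LBINT u. cmod (char \<rho> u))" for v
  proof -
    have "cmod (CLBINT u. exp (- \<i> * complex_of_real ((x - v) * u)) * char \<rho> u)
       \<le> (LBINT u. cmod (exp (- \<i> * complex_of_real ((x - v) * u)) * char \<rho> u))"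
      by (rule integral_norm_bound)
    then show ?thesis unfolding char_density_def
      by (simp add: norm_mult norm_divide divide_right_mono)
  qed
  have intf: "integrable \<nu> ?f"
    by (rule N.integrable_const_bound[OF AE_I2[OF bd]]) simp
  then have eq: "Re (char_density \<mu> x) = (LINT v|\<nu>. Re (?f v))"
    by (simp add: char_density_mult[OF \<nu> \<rho> int char])
  have "integrable \<nu> (\<lambda>v. indicator {w} v * Re (?f w))"
    by (rule N.integrable_const_bound[where B="\<bar>Re (?f w)\<bar>"]) (auto simp: indicator_def)
  then have "(LINT v|\<nu>. indicator {w} v * Re (?f w)) \<le> (LINT v|\<nu>. Re (?f v))"
    using intf nn by (intro integral_mono) (auto simp: indicator_def)
  moreover have "(LINT v|\<nu>. indicator {w} v * Re (?f w)) = measure \<nu> {w} * Re (?f w)"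
    by simp
  ultimately have "measure \<nu> {w} * Re (?f w) \<le> 0" using le eq by linarith
  then have "Re (?f w) \<le> 0" using pos by (simp add: mult_le_0_iff)
  then show ?thesis using nn[of w] by (auto elim!: Reals_cases)
qed

section \<open>The local terms\<close>

text \<open>On this range the Taylor remainder after 1 - x^2 / 2 is at most x^2 / 24, which leaves
  more than half of the quadratic term.\<close>

lemma cos_abs_bound:
  fixes x :: real
  assumes "\<bar>x\<bar> \<le> 1"
  shows "\<bar>cos x\<bar> \<le> 1 - x\<^sup>2 / 4"
proof -
  obtain t where t: "cos x = (\<Sum>m<4. cos_coeff m * x ^ m) + (cos (t + 1/2 * real 4 * pi) / fact 4) * x ^ 4"
    using Maclaurin_cos_expansion[where x=x and n=4] by metis
  have s: "(\<Sum>m<4. cos_coeff m * x ^ m) = 1 - x\<^sup>2 / 2"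
  proof -
    have "{..<4} = {0, 1, 2, 3::nat}" by auto
    then show ?thesis by (simp add: cos_coeff_def fact_numeral)
  qed
  have x2: "x\<^sup>2 \<le> 1" using assms by (simp add: abs_square_le_1)
  have "x ^ 4 = x\<^sup>2 * x\<^sup>2" by (simp add: eval_nat_numeral)
  then have x4: "x ^ 4 \<le> x\<^sup>2" using x2 mult_left_le[of "x\<^sup>2" "x\<^sup>2"] by simp
  define r where "r = (cos (t + 1/2 * real 4 * pi) / fact 4) * x ^ 4"
  have "\<bar>r\<bar> = \<bar>cos (t + 1/2 * real 4 * pi)\<bar> * (x ^ 4 / 24)"
    unfolding r_def by (simp add: abs_mult fact_numeral)
  also have "\<dots> \<le> 1 * (x ^ 4 / 24)" by (intro mult_right_mono abs_cos_le_one) auto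
  finally have "\<bar>r\<bar> \<le> x\<^sup>2 / 24" using x4 by linarith
  moreover have "cos x = 1 - x\<^sup>2 / 2 + r" using t unfolding s r_def .
  ultimately show ?thesis using x2 by linarith
qed

section \<open>Random characters and the local term of a prime\<close>

lemma countable_prime_polys: "countable (prime_polys :: 'a::{field,finite} poly set)"
proof -
  have "prime_polys \<subseteq> (\<Union>d. prime_polys_deg d :: 'a poly set)" by (auto simp: prime_polys_deg_def)
  moreover have "countable (\<Union>d. prime_polys_deg d :: 'a poly set)"
    by (intro countable_UN countableI_type countable_finite finite_prime_polys_deg)
  ultimately show ?thesis by (rule countable_subset)
qed

text \<open>\<open>q\<close> is the field size as a real number. That it is a power of an odd prime
  enters through \<open>card_ge_3\<close>.\<close>

locale random_characters = prob_space M
  for M :: "'w measure" +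
  fixes X :: "'a::{field, finite} poly \<Rightarrow> 'w \<Rightarrow> real"
    and q :: real
  assumes q_def: "q = real CARD('a)"
    and card_ge_3: "CARD('a) \<ge> 3"
    and indep_X: "indep_vars (\<lambda>_. borel) X prime_polys"
    and prob_X_1: "P \<in> prime_polys \<Longrightarrow>
      measure M {\<omega> \<in> space M. X P \<omega> = 1} = poly_norm P / (2 * (poly_norm P + 1))"
    and prob_X_m1: "P \<in> prime_polys \<Longrightarrow>
      measure M {\<omega> \<in> space M. X P \<omega> = -1} = poly_norm P / (2 * (poly_norm P + 1))"
    and prob_X_0: "P \<in> prime_polys \<Longrightarrow>
      measure M {\<omega> \<in> space M. X P \<omega> = 0} = 1 / (poly_norm P + 1)"
begin

lemma X_measurable [measurable]: "P \<in> prime_polys \<Longrightarrow> X P \<in> borel_measurable M"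
  using indep_X by (simp add: indep_vars_def2)

lemma poly_norm_pos: "poly_norm (P :: 'a poly) > 0"
  by (simp add: poly_norm_def)

lemma poly_norm_ge_3: "P \<in> prime_polys \<Longrightarrow> poly_norm (P :: 'a poly) \<ge> 3"
proof -
  assume "P \<in> prime_polys"
  then have "real CARD('a) ^ 1 \<le> real CARD('a) ^ degree P"
    using card_ge_3 prime_polysD(4)[of P] by (intro power_increasing) auto
  moreover have "real CARD('a) \<ge> 3" using card_ge_3 by linarith
  ultimately show ?thesis unfolding poly_norm_def power_one_right by linarith
qed

text \<open>The three prescribed probabilities add up to 1, which leaves no room for other
  values.\<close>

lemma AE_X_values:
  assumes P: "P \<in> prime_polys"
  shows "AE \<omega> in M. X P \<omega> \<in> {1, -1, 0}"
proof -
  note [measurable] = X_measurable[OF P]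
  let ?A = "\<lambda>v. {\<omega> \<in> space M. X P \<omega> = v}"
  have A: "?A v \<in> sets M" for v by measurable
  have "prob (?A 1 \<union> (?A (-1) \<union> ?A 0)) = prob (?A 1) + prob (?A (-1) \<union> ?A 0)"
    by (rule finite_measure_Union) (auto intro: A)
  also have "prob (?A (-1) \<union> ?A 0) = prob (?A (-1)) + prob (?A 0)"
    by (rule finite_measure_Union) (auto intro: A)
  also have "prob (?A 1) + (prob (?A (-1)) + prob (?A 0)) = 1"
  proof -
    have "N / (2 * (N + 1)) + (N / (2 * (N + 1)) + 1 / (N + 1)) = 1" if "N > 0" for N :: real
      using that by (simp add: divide_simps) (simp add: algebra_simps)
    then show ?thesis unfolding prob_X_1[OF P] prob_X_m1[OF P] prob_X_0[OF P] using poly_norm_pos .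
  qed
  finally have "AE \<omega> in M. \<omega> \<in> ?A 1 \<union> (?A (-1) \<union> ?A 0)"
    using A by (subst (asm) prob_eq_1) blast+
  then show ?thesis by eventually_elim auto
qed

lemma expectation_X:
  fixes h :: "real \<Rightarrow> 'b::{banach, second_countable_topology}"
  assumes P: "P \<in> prime_polys" and [measurable]: "h \<in> borel_measurable borel"
  shows "integrable M (\<lambda>\<omega>. h (X P \<omega>))"
    and "(LINT \<omega>|M. h (X P \<omega>)) =
      (poly_norm P / (2 * (poly_norm P + 1))) *\<^sub>R (h 1 + h (-1)) + (1 / (poly_norm P + 1)) *\<^sub>R h 0"
proof -
  note [measurable] = X_measurable[OF P]
  let ?A = "\<lambda>v. {\<omega> \<in> space M. X P \<omega> = v}"
  let ?g = "\<lambda>\<omega>. indicator (?A 1) \<omega> *\<^sub>R h 1 + (indicator (?A (-1)) \<omega> *\<^sub>R h (-1) + indicator (?A 0) \<omega> *\<^sub>R h 0)"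
  have AE: "AE \<omega> in M. h (X P \<omega>) = ?g \<omega>"
    using AE_X_values[OF P] AE_space by eventually_elim (auto simp: indicator_def)
  have i: "integrable M (\<lambda>\<omega>. indicator (?A v) \<omega> *\<^sub>R h w)" for v w
    by (intro integrable_scaleR_left integrable_real_indicator) (auto simp: emeasure_eq_measure)
  have ig: "integrable M ?g" by (intro Bochner_Integration.integrable_add i)
  have mh: "(\<lambda>\<omega>. h (X P \<omega>)) \<in> borel_measurable M" by measurable
  show "integrable M (\<lambda>\<omega>. h (X P \<omega>))"
    using integrable_cong_AE[OF mh borel_measurable_integrable[OF ig] AE] ig by (rule iffD2)
  have "(LINT \<omega>|M. h (X P \<omega>)) = (LINT \<omega>|M. ?g \<omega>)"
    by (rule integral_cong_AE[OF mh borel_measurable_integrable[OF ig] AE])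
  also have "\<dots> = prob (?A 1) *\<^sub>R h 1 + (prob (?A (-1)) *\<^sub>R h (-1) + prob (?A 0) *\<^sub>R h 0)"
    using i by (simp add: emeasure_eq_measure)
  also have "\<dots> = (poly_norm P / (2 * (poly_norm P + 1))) *\<^sub>R (h 1 + h (-1)) + (1 / (poly_norm P + 1)) *\<^sub>R h 0"
    by (simp add: prob_X_1[OF P] prob_X_m1[OF P] prob_X_0[OF P] scaleR_add_right)
  finally show "(LINT \<omega>|M. h (X P \<omega>)) =
      (poly_norm P / (2 * (poly_norm P + 1))) *\<^sub>R (h 1 + h (-1)) + (1 / (poly_norm P + 1)) *\<^sub>R h 0" .
qed

text \<open>This comes from x / (N - x) = (N x + x^2) / (N^2 - x^2): for x = 1, -1, 0 the
  denominator may be replaced by N^2 - 1, the numerator being 0 at x = 0.\<close>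

definition coef :: "'a poly \<Rightarrow> real"
  where "coef P = ln (poly_norm P) / ((poly_norm P)\<^sup>2 - 1)"

text \<open>
  On the values 1, -1, 0 of \<open>X P\<close> this polynomial agrees with \<open>log N(P) * X P / (N(P) - X P)\<close>, the sum of
  the geometric series of the prime powers of \<open>P\<close>.
\<close>
definition Y :: "'a poly \<Rightarrow> 'w \<Rightarrow> real"
  where "Y P \<omega> = coef P * (poly_norm P * X P \<omega> + (X P \<omega>)\<^sup>2)"

lemma Y_measurable [measurable]: "P \<in> prime_polys \<Longrightarrow> Y P \<in> borel_measurable M"
  unfolding Y_def by measurable

lemma indep_Y: "indep_vars (\<lambda>_. borel) Y prime_polys"
  unfolding Y_def by (rule indep_vars_compose2[OF indep_X]) measurable

text \<open>At 1 and -1 the values of \<open>Y P\<close> are \<open>coef P\<close> times 1 + N and 1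
  - N, so the two exponentials share the phase \<open>u * coef P\<close> and combine to a cosine of
  \<theta> = \<open>u * (coef P * N)\<close>. The 1/8 is the 1/4 of \<open>cos_abs_bound\<close>
  times the lower bound 1/2 for N / (N + 1).\<close>

lemma char_Y_bound:
  assumes P: "P \<in> prime_polys" and u: "\<bar>u * (coef P * poly_norm P)\<bar> \<le> 1"
  shows "cmod (char (distr M borel (Y P)) u) \<le> exp (- (u * (coef P * poly_norm P))\<^sup>2 / 8)"
proof -
  note [measurable] = X_measurable[OF P] Y_measurable[OF P]
  let ?N = "poly_norm P" let ?c = "coef P"
  define \<theta> where "\<theta> = u * (?c * ?N)"
  have N: "?N \<ge> 3" by (rule poly_norm_ge_3[OF P])
  have "char (distr M borel (Y P)) u = (CLINT \<omega>|M. iexp (u * (?c * (?N * X P \<omega> + (X P \<omega>)\<^sup>2))))"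
    unfolding char_def Y_def[symmetric] by (simp add: integral_distr)
  also have "\<dots> = (?N / (2 * (?N + 1))) *\<^sub>R (iexp (u * (?c * (?N * 1 + 1\<^sup>2))) + iexp (u * (?c * (?N * (-1) + (-1)\<^sup>2))))
      + (1 / (?N + 1)) *\<^sub>R iexp (u * (?c * (?N * 0 + 0\<^sup>2)))"
    by (rule expectation_X(2)[OF P, of "\<lambda>x. iexp (u * (?c * (?N * x + x\<^sup>2)))"]) measurable
  also have "iexp (u * (?c * (?N * 1 + 1\<^sup>2))) + iexp (u * (?c * (?N * (-1) + (-1)\<^sup>2)))
      = iexp (u * ?c) * (iexp \<theta> + iexp (- \<theta>))"
    unfolding \<theta>_def by (simp add: exp_add[symmetric] algebra_simps)
  also have "iexp \<theta> + iexp (- \<theta>) = complex_of_real (2 * cos \<theta>)"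
    by (simp add: complex_eq_iff Re_exp Im_exp)
  finally have "char (distr M borel (Y P)) u =
      (?N / (2 * (?N + 1))) *\<^sub>R (iexp (u * ?c) * complex_of_real (2 * cos \<theta>)) + (1 / (?N + 1)) *\<^sub>R 1" by simp
  also have "cmod \<dots> \<le> cmod ((?N / (2 * (?N + 1))) *\<^sub>R (iexp (u * ?c) * complex_of_real (2 * cos \<theta>))) + cmod ((1 / (?N + 1)) *\<^sub>R 1)"
    by (rule norm_triangle_ineq)
  also have "\<dots> = ?N / (?N + 1) * \<bar>cos \<theta>\<bar> + 1 / (?N + 1)"
  proof -
    have "cmod ((?N / (2 * (?N + 1))) *\<^sub>R (iexp (u * ?c) * complex_of_real (2 * cos \<theta>)))
        = \<bar>?N / (2 * (?N + 1))\<bar> * (1 * \<bar>2 * cos \<theta>\<bar>)"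
      unfolding norm_scaleR norm_mult norm_exp_i_times norm_of_real ..
    also have "\<dots> = ?N / (?N + 1) * \<bar>cos \<theta>\<bar>"
    proof -
      have "\<bar>n / (2 * (n + 1))\<bar> * (1 * \<bar>2 * c\<bar>) = n / (n + 1) * \<bar>c\<bar>" if "n \<ge> 3" for n c :: real
        using that by (simp add: abs_mult field_simps)
      then show ?thesis using N .
    qed
    finally show ?thesis using N by simp
  qed
  also have "\<dots> \<le> ?N / (?N + 1) * (1 - \<theta>\<^sup>2 / 4) + 1 / (?N + 1)"
    using N u by (intro add_mono mult_left_mono cos_abs_bound) (auto simp: \<theta>_def)
  also have "\<dots> = 1 - ?N / (?N + 1) * (\<theta>\<^sup>2 / 4)"
  proof -
    have "1 / (?N + 1) = 1 - ?N / (?N + 1)" using N by (simp add: field_simps)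
    then show ?thesis by (simp add: right_diff_distrib)
  qed
  also have "\<dots> \<le> 1 - (1 / 2) * (\<theta>\<^sup>2 / 4)"
    using N by (intro diff_left_mono mult_right_mono) (auto simp: field_simps)
  also have "\<dots> \<le> exp (- \<theta>\<^sup>2 / 8)" using exp_ge_add_one_self[of "- \<theta>\<^sup>2 / 8"] by simp
  finally show ?thesis by (simp add: \<theta>_def)
qed

end

section \<open>The series over prime powers\<close>

lemma poly_norm_power: "poly_norm (f ^ k) = poly_norm f ^ k"
  by (cases "f = 0") (simp_all add: poly_norm_def degree_power_eq power_0_left flip: power_mult add: mult.commute)

lemma prime_polys_power_eq:
  fixes P Q :: "'a::field poly"
  assumes P: "P \<in> prime_polys" and Q: "Q \<in> prime_polys" and k: "k \<ge> 1" and eq: "P ^ k = Q ^ l"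
  shows "P = Q \<and> k = l"
proof -
  have "P dvd Q ^ l" using k eq[symmetric] by (simp add: dvd_power)
  then have "P dvd Q" using prime_polysD(3)[OF P] prime_elem_dvd_power by blast
  then have PQ: "P = Q" by (rule prime_polys_dvd_eq[OF P Q])
  then have "k * degree P = l * degree P" using eq by (metis degree_prime_power[OF P])
  then show ?thesis using PQ prime_polysD(4)[OF P] by simp
qed

lemma poly_mangoldt_prime_power:
  fixes P :: "'a::{field,finite} poly"
  assumes P: "P \<in> prime_polys" and k: "k \<ge> 1"
  shows "poly_mangoldt (P ^ k) = ln (poly_norm P)"
proof -
  have "(THE Q. Q \<in> prime_polys \<and> (\<exists>j\<ge>1. P ^ k = Q ^ j)) = P"
  proof (rule the_equality)
    show "P \<in> prime_polys \<and> (\<exists>j\<ge>1. P ^ k = P ^ j)" using P k by blast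
  next
    fix Q assume "Q \<in> prime_polys \<and> (\<exists>j\<ge>1. P ^ k = Q ^ j)"
    then show "Q = P" using prime_polys_power_eq[OF P _ k] by blast
  qed
  then show ?thesis using P k unfolding poly_mangoldt_def by auto
qed

lemma poly_ord_prime_power:
  fixes P :: "'a::field poly"
  assumes P: "P \<in> prime_polys"
  shows "poly_ord P (P ^ k) = k"
proof -
  have "P ^ j dvd P ^ k \<longleftrightarrow> j \<le> k" for j
    using prime_polysD(5,6)[OF P] dvd_power_iff[of P j k] by simp
  then have "{j. P ^ j dvd P ^ k} = {..k}" by auto
  moreover have "Max {..k} = k" by (rule Max_eqI) auto
  ultimately show ?thesis by (simp add: poly_ord_def)
qed

lemma mult_ext_prime_power:
  fixes P :: "'a::field poly"
  assumes P: "P \<in> prime_polys" and k: "k \<ge> 1"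
  shows "mult_ext X (P ^ k) \<omega> = X P \<omega> ^ k"
proof -
  have "Q dvd P ^ k \<longleftrightarrow> Q = P" if Q: "Q \<in> prime_polys" for Q
  proof
    assume "Q dvd P ^ k"
    then have "Q dvd P" using prime_polysD(3)[OF Q] prime_elem_dvd_power by blast
    then show "Q = P" by (rule prime_polys_dvd_eq[OF Q P])
  next
    assume "Q = P"
    then show "Q dvd P ^ k" using k by (simp add: dvd_power)
  qed
  then have "{Q \<in> prime_polys. Q dvd P ^ k} = {P}" using P by auto
  then show ?thesis by (simp add: mult_ext_def poly_ord_prime_power[OF P])
qed

text \<open>Only prime powers P^k carry a nonzero coefficient, and the cutoff k * degree P <= m
  truncates the geometric series of a prime of degree d after \<open>m div d\<close> terms.\<close>

lemma sum_mangoldt_eq: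
  fixes X :: "'a::{field,finite} poly \<Rightarrow> 'w \<Rightarrow> real"
  shows "(\<Sum>f | f \<in> monic_polys \<and> degree f \<le> m. poly_mangoldt f / poly_norm f * mult_ext X f \<omega>)
    = (\<Sum>d\<in>{1..m}. \<Sum>P\<in>prime_polys_deg d. \<Sum>k\<in>{1..m div d}. ln (poly_norm P) * (X P \<omega> / poly_norm P) ^ k)"
proof -
  let ?F = "\<lambda>f. poly_mangoldt f / poly_norm f * mult_ext X f \<omega>"
  let ?I = "Sigma (\<Union>d\<in>{1..m}. prime_polys_deg d :: 'a poly set) (\<lambda>P. {1..m div degree P})"
  let ?h = "\<lambda>(P, k). P ^ k :: 'a poly"
  have finP: "finite (\<Union>d\<in>{1..m}. prime_polys_deg d :: 'a poly set)"
    by (intro finite_UN_I finite_prime_polys_deg) simp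
  have inj: "inj_on ?h ?I"
  proof (rule inj_onI, clarify)
    fix P Q :: "'a poly" and k l d e
    assume "k \<in> {1..m div degree P}" "P \<in> prime_polys_deg d" "Q \<in> prime_polys_deg e" "P ^ k = Q ^ l"
    then show "P = Q \<and> k = l" using prime_polys_power_eq[of P Q k l] by (simp add: prime_polys_deg_def)
  qed
  have sub: "?h ` ?I \<subseteq> {f. f \<in> monic_polys \<and> degree f \<le> m}"
  proof clarify
    fix P :: "'a poly" and k d
    assume k: "k \<in> {1..m div degree P}" and "P \<in> prime_polys_deg d"
    then have P: "P \<in> prime_polys" by (simp add: prime_polys_deg_def)
    have "k * degree P \<le> m div degree P * degree P" using k by (intro mult_right_mono) auto
    also have "\<dots> \<le> m" by simp
    finally show "P ^ k \<in> monic_polys \<and> degree (P ^ k) \<le> m"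
      using P by (simp add: degree_prime_power monic_polys_power prime_polysD(1))
  qed
  have out: "?F f = 0" if f: "f \<in> {f. f \<in> monic_polys \<and> degree f \<le> m} - ?h ` ?I" for f
  proof -
    have "\<not> (\<exists>P\<in>prime_polys. \<exists>k\<ge>1. f = P ^ k)"
    proof
      assume "\<exists>P\<in>prime_polys. \<exists>k\<ge>1. f = P ^ k"
      then obtain P k where Pk: "P \<in> prime_polys" "k \<ge> 1" "f = P ^ k" by blast
      have pos: "degree P > 0" by (rule prime_polysD(4)[OF Pk(1)])
      have le: "k * degree P \<le> m" using f Pk(3) degree_prime_power[OF Pk(1), of k] by simp
      have "1 * degree P \<le> k * degree P" using Pk(2) by (intro mult_right_mono) auto
      then have "degree P \<le> m" using le by linarith
      then have "P \<in> prime_polys_deg (degree P)" "degree P \<in> {1..m}" "k \<in> {1..m div degree P}"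
        using Pk(1,2) pos le by (simp_all add: prime_polys_deg_def less_eq_div_iff_mult_less_eq)
      then have "(P, k) \<in> ?I" by blast
      then have "?h (P, k) \<in> ?h ` ?I" by (rule imageI)
      then show False using f Pk(3) by simp
    qed
    then have "poly_mangoldt f = 0" unfolding poly_mangoldt_def by (rule if_not_P)
    then show ?thesis by simp
  qed
  have "(\<Sum>f | f \<in> monic_polys \<and> degree f \<le> m. ?F f) = (\<Sum>f\<in>?h ` ?I. ?F f)"
    using finite_monic_le[of m] sub out by (intro sum.mono_neutral_right) auto
  also have "\<dots> = (\<Sum>x\<in>?I. ?F (?h x))" by (subst sum.reindex[OF inj]) simp
  also have "\<dots> = (\<Sum>P\<in>(\<Union>d\<in>{1..m}. prime_polys_deg d). \<Sum>k\<in>{1..m div degree P}. ?F (P ^ k))"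
    using finP by (subst sum.Sigma) (auto simp: case_prod_unfold)
  also have "\<dots> = (\<Sum>d\<in>{1..m}. \<Sum>P\<in>prime_polys_deg d. \<Sum>k\<in>{1..m div degree P}. ?F (P ^ k))"
  proof (rule sum.UNION_disjoint)
    show "\<forall>i\<in>{1..m}. \<forall>j\<in>{1..m}. i \<noteq> j \<longrightarrow> prime_polys_deg i \<inter> (prime_polys_deg j :: 'a poly set) = {}"
      unfolding prime_polys_deg_def by blast
  qed (simp_all add: finite_prime_polys_deg)
  also have "\<dots> = (\<Sum>d\<in>{1..m}. \<Sum>P\<in>prime_polys_deg d. \<Sum>k\<in>{1..m div d}. ln (poly_norm P) * (X P \<omega> / poly_norm P) ^ k)"
  proof (intro sum.cong refl)
    fix d and P :: "'a poly" and k
    assume "P \<in> prime_polys_deg d" "k \<in> {1..m div d}"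
    then show "?F (P ^ k) = ln (poly_norm P) * (X P \<omega> / poly_norm P) ^ k"
      using poly_mangoldt_prime_power[of P k] mult_ext_prime_power[of P k X \<omega>]
      by (simp add: prime_polys_deg_def poly_norm_power power_divide)
  qed (simp add: prime_polys_deg_def)
  finally show ?thesis .
qed

section \<open>Almost sure convergence\<close>

context random_characters begin

lemma q_ge_3: "q \<ge> 3" using card_ge_3 by (simp add: q_def)

text \<open>Grouping by degree is what makes absolute convergence possible: a single term of degree
  d has first moment of order d / q^d, and there are about q^d / d of them, a total that does not
  tend to 0. Within a block the signs cancel.\<close>

definition block :: "nat \<Rightarrow> 'w \<Rightarrow> real"
  where "block d \<omega> = (\<Sum>P\<in>prime_polys_deg d. Y P \<omega>)"

lemma prime_polys_degD:
  assumes "P \<in> prime_polys_deg d"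
  shows "P \<in> prime_polys" "poly_norm (P :: 'a poly) = q ^ d"
  using assms by (auto simp: prime_polys_deg_def poly_norm_def q_def)

lemma block_measurable [measurable]: "block d \<in> borel_measurable M"
  unfolding block_def using prime_polys_degD by (intro borel_measurable_sum) auto

lemma card_prime_polys_deg_le: "d \<ge> 1 \<Longrightarrow> real (card (prime_polys_deg d :: 'a poly set)) * d \<le> q ^ d"
  using of_nat_mono[OF prime_polys_deg_upper[of d, where 'a='a], where 'a=real] by (simp add: mult.commute q_def)

lemma card_prime_polys_deg_ge: "d \<ge> 1 \<Longrightarrow> q ^ d / 2 \<le> real (card (prime_polys_deg d :: 'a poly set)) * d"
  using of_nat_mono[OF prime_polys_deg_lower[of d, where 'a='a], where 'a=real] card_ge_3 by (simp add: mult_ac q_def)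

text \<open>The symmetric law gives mean zero, so independence makes different \<open>X P\<close>
  orthogonal.\<close>

lemma expectation_X_prod:
  assumes P: "P \<in> prime_polys" and Q: "Q \<in> prime_polys"
  shows "integrable M (\<lambda>\<omega>. X P \<omega> * X Q \<omega>)"
    and "expectation (\<lambda>\<omega>. X P \<omega> * X Q \<omega>) \<le> (if P = Q then 1 else 0)"
proof -
  have "integrable M (\<lambda>\<omega>. X P \<omega> * X Q \<omega>) \<and> expectation (\<lambda>\<omega>. X P \<omega> * X Q \<omega>) \<le> (if P = Q then 1 else 0)"
  proof (cases "P = Q")
    case True
    have "expectation (\<lambda>\<omega>. X P \<omega> * X P \<omega>) = poly_norm P / (poly_norm P + 1)"
      using expectation_X(2)[OF P, of "\<lambda>x. x * x"] poly_norm_pos[of P] by (simp add: field_simps)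
    also have "\<dots> \<le> 1" using poly_norm_pos[of P] by simp
    finally show ?thesis using True expectation_X(1)[OF P, of "\<lambda>x. x * x"] by simp
  next
    case False
    have ind: "indep_vars (\<lambda>_. borel) X {P, Q}"
      by (rule indep_vars_subset[OF indep_X]) (use P Q in auto)
    have int: "integrable M (X R)" and E0: "expectation (X R) = 0" if "R \<in> {P, Q}" for R
      using that P Q expectation_X[of R "\<lambda>x. x"] by auto
    have "(\<lambda>\<omega>. \<Prod>R\<in>{P, Q}. X R \<omega>) = (\<lambda>\<omega>. X P \<omega> * X Q \<omega>)" using False by auto
    then show ?thesis
      using indep_vars_lebesgue_integral[OF _ ind int] indep_vars_integrable[OF _ ind int] E0 False by simp
  qed
  then show "integrable M (\<lambda>\<omega>. X P \<omega> * X Q \<omega>)"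
    "expectation (\<lambda>\<omega>. X P \<omega> * X Q \<omega>) \<le> (if P = Q then 1 else 0)" by auto
qed

lemma expectation_sum_X_squared:
  assumes F: "finite F" "F \<subseteq> prime_polys"
  shows "integrable M (\<lambda>\<omega>. (\<Sum>P\<in>F. X P \<omega>)\<^sup>2)"
    and "expectation (\<lambda>\<omega>. (\<Sum>P\<in>F. X P \<omega>)\<^sup>2) \<le> card F"
proof -
  have eq: "(\<lambda>\<omega>. (\<Sum>P\<in>F. X P \<omega>)\<^sup>2) = (\<lambda>\<omega>. \<Sum>P\<in>F. \<Sum>Q\<in>F. X P \<omega> * X Q \<omega>)"
    by (simp add: power2_eq_square sum_product)
  have int: "integrable M (\<lambda>\<omega>. X P \<omega> * X Q \<omega>)" if "P \<in> F" "Q \<in> F" for P Q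
    using expectation_X_prod(1) that F by blast
  show "integrable M (\<lambda>\<omega>. (\<Sum>P\<in>F. X P \<omega>)\<^sup>2)"
    unfolding eq by (intro Bochner_Integration.integrable_sum int)
  have "expectation (\<lambda>\<omega>. (\<Sum>P\<in>F. X P \<omega>)\<^sup>2) = (\<Sum>P\<in>F. \<Sum>Q\<in>F. expectation (\<lambda>\<omega>. X P \<omega> * X Q \<omega>))"
    unfolding eq
    by (subst Bochner_Integration.integral_sum, intro Bochner_Integration.integrable_sum int, assumption, assumption,
        intro sum.cong refl Bochner_Integration.integral_sum int)
  also have "\<dots> \<le> (\<Sum>P\<in>F. \<Sum>Q\<in>F. if P = Q then 1 else 0)"
    using F(2) by (intro sum_mono expectation_X_prod) auto
  also have "\<dots> = card F" using F(1) by simp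
  finally show "expectation (\<lambda>\<omega>. (\<Sum>P\<in>F. X P \<omega>)\<^sup>2) \<le> card F" .
qed

lemma ln_over_square_bounds:
  assumes "N \<ge> (3::real)"
  shows "0 \<le> ln N / (N\<^sup>2 - 1)" "ln N / (N\<^sup>2 - 1) \<le> 2 * ln N / N\<^sup>2"
proof -
  have "9 \<le> N\<^sup>2" using assms power_mono[of 3 N 2] by simp
  then show "0 \<le> ln N / (N\<^sup>2 - 1)" using assms by simp
  have "ln N / (N\<^sup>2 - 1) \<le> ln N / (N\<^sup>2 / 2)"
    using \<open>9 \<le> N\<^sup>2\<close> assms by (intro divide_left_mono) auto
  then show "ln N / (N\<^sup>2 - 1) \<le> 2 * ln N / N\<^sup>2" by (simp add: mult.commute)
qed

lemma q_power_ge_3: "d \<ge> 1 \<Longrightarrow> q ^ d \<ge> 3"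
  using power_increasing[of 1 d q] q_ge_3 by simp

text \<open>Up to the factor ln N / (N^2 - 1) the block is N S + R, with S the sum of the
  \<open>X P\<close> and R that of their squares. Orthogonality bounds the second moment of S by the
  number of primes, at most N = q^d, so N S has order at most N^(3/2). This leaves ln N / sqrt
  N.\<close>

lemma expectation_abs_block:
  assumes d: "d \<ge> 1"
  shows "integrable M (block d)" and "expectation (\<lambda>\<omega>. \<bar>block d \<omega>\<bar>) \<le> 4 * ln q * (real d * (1 / sqrt q) ^ d)"
proof -
  let ?F = "prime_polys_deg d :: 'a poly set"
  let ?N = "q ^ d" let ?n = "real (card ?F)"
  let ?S = "\<lambda>\<omega>. \<Sum>P\<in>?F. X P \<omega>" and ?R = "\<lambda>\<omega>. \<Sum>P\<in>?F. (X P \<omega>)\<^sup>2"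
  let ?c = "ln ?N / (?N\<^sup>2 - 1)"
  have F: "finite ?F" "?F \<subseteq> prime_polys" using finite_prime_polys_deg prime_polys_degD by auto
  have N: "?N \<ge> 3" using q_power_ge_3[OF d] .
  have n: "?n \<le> ?N"
  proof -
    have "?n * 1 \<le> ?n * d" using d by (intro mult_left_mono) auto
    then show ?thesis using card_prime_polys_deg_le[OF d] by linarith
  qed
  have block: "block d \<omega> = ?c * (?N * ?S \<omega> + ?R \<omega>)" for \<omega>
    unfolding block_def Y_def coef_def
    by (simp add: prime_polys_degD(2) sum_distrib_left sum.distrib[symmetric] cong: sum.cong)
  have int1: "integrable M (X P)" "integrable M (\<lambda>\<omega>. (X P \<omega>)\<^sup>2)" if "P \<in> ?F" for P
    using expectation_X(1)[of P "\<lambda>x. x"] expectation_X(1)[of P "\<lambda>x. x\<^sup>2"] that F(2) by auto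
  have intS: "integrable M ?S" and intR: "integrable M ?R"
    using int1 by (auto intro!: Bochner_Integration.integrable_sum)
  show "integrable M (block d)" unfolding block by (intro integrable_mult_right Bochner_Integration.integrable_add intS intR)
  \<comment> \<open>The inequality |S| <= (S^2 / s + s) / 2 takes the place of Cauchy-Schwarz; s =
    sqrt N balances its two terms, since S^2 has mean at most N.\<close>
  let ?s = "sqrt ?N"
  have s: "?s > 0" "?s * ?s = ?N" using N by auto
  have bound: "\<bar>block d \<omega>\<bar> \<le> ?c * (?N * (((?S \<omega>)\<^sup>2 / ?s + ?s) / 2) + ?R \<omega>)" for \<omega>
  proof -
    have "2 * \<bar>?S \<omega>\<bar> * ?s \<le> (?S \<omega>)\<^sup>2 + ?s\<^sup>2"
      using sum_squares_bound[of "\<bar>?S \<omega>\<bar>" ?s] by simp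
    moreover have "a \<le> (b / s + s) / 2" if "2 * a * s \<le> b + s\<^sup>2" "s > 0" for a b s :: real
    proof -
      have "a \<le> (b + s\<^sup>2) / (2 * s)" using that by (simp add: pos_le_divide_eq mult_ac)
      also have "\<dots> = (b / s + s) / 2" using that(2) by (simp add: field_simps power2_eq_square)
      finally show ?thesis .
    qed
    ultimately have "\<bar>?S \<omega>\<bar> \<le> ((?S \<omega>)\<^sup>2 / ?s + ?s) / 2"
      using s(1) by blast
    then have "\<bar>?N * ?S \<omega> + ?R \<omega>\<bar> \<le> ?N * (((?S \<omega>)\<^sup>2 / ?s + ?s) / 2) + ?R \<omega>"
    proof -
      have "\<bar>?N * ?S \<omega> + ?R \<omega>\<bar> \<le> \<bar>?N * ?S \<omega>\<bar> + \<bar>?R \<omega>\<bar>" by (rule abs_triangle_ineq)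
      also have "\<bar>?R \<omega>\<bar> = ?R \<omega>" by (intro abs_of_nonneg sum_nonneg) auto
      also have "\<bar>?N * ?S \<omega>\<bar> = ?N * \<bar>?S \<omega>\<bar>" using N by (simp add: abs_mult)
      also have "?N * \<bar>?S \<omega>\<bar> \<le> ?N * (((?S \<omega>)\<^sup>2 / ?s + ?s) / 2)"
        using N \<open>\<bar>?S \<omega>\<bar> \<le> _\<close> by (intro mult_left_mono) auto
      finally show ?thesis by simp
    qed
    have "\<bar>block d \<omega>\<bar> = ?c * \<bar>?N * ?S \<omega> + ?R \<omega>\<bar>"
      unfolding block abs_mult abs_of_nonneg[OF ln_over_square_bounds(1)[OF N]] ..
    also have "\<dots> \<le> ?c * (?N * (((?S \<omega>)\<^sup>2 / ?s + ?s) / 2) + ?R \<omega>)"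
      using \<open>\<bar>?N * ?S \<omega> + ?R \<omega>\<bar> \<le> _\<close> ln_over_square_bounds(1)[OF N] by (rule mult_left_mono)
    finally show ?thesis .
  qed
  have intS2: "integrable M (\<lambda>\<omega>. (?S \<omega>)\<^sup>2)" and ES2: "expectation (\<lambda>\<omega>. (?S \<omega>)\<^sup>2) \<le> ?n"
    using expectation_sum_X_squared[OF F] by auto
  have ER: "expectation ?R \<le> ?n"
  proof -
    have "expectation ?R = (\<Sum>P\<in>?F. expectation (\<lambda>\<omega>. (X P \<omega>)\<^sup>2))"
      using int1 by (intro Bochner_Integration.integral_sum) auto
    also have "\<dots> \<le> (\<Sum>P\<in>?F. 1)"
      using F(2) expectation_X_prod(2) by (intro sum_mono) (fastforce simp: power2_eq_square)
    finally show ?thesis by simp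
  qed
  have "expectation (\<lambda>\<omega>. \<bar>block d \<omega>\<bar>) \<le> expectation (\<lambda>\<omega>. ?c * (?N * (((?S \<omega>)\<^sup>2 / ?s + ?s) / 2) + ?R \<omega>))"
    using \<open>integrable M (block d)\<close> intS2 intR bound by (intro integral_mono) auto
  also have "\<dots> = ?c * (?N * ((expectation (\<lambda>\<omega>. (?S \<omega>)\<^sup>2) / ?s + ?s) / 2) + expectation ?R)"
    using intS2 intR by (simp add: prob_space)
  also have "\<dots> \<le> ?c * (?N * ((?N / ?s + ?s) / 2) + ?N)"
    using ln_over_square_bounds(1)[OF N] s(1) N n ES2 ER
    by (intro mult_left_mono add_mono divide_right_mono) auto
  also have "?N / ?s = ?s" using N by (intro real_div_sqrt) linarith
  also have "?c * (?N * ((?s + ?s) / 2) + ?N) \<le> ?c * (?N * ?s + ?N * ?s)"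
  proof -
    have "1 \<le> ?s" using N by simp
    then have "?N * 1 \<le> ?N * ?s" using N by (intro mult_left_mono) auto
    then show ?thesis using ln_over_square_bounds(1)[OF N] by (intro mult_left_mono) auto
  qed
  also have "\<dots> \<le> (2 * ln ?N / ?N\<^sup>2) * (?N * ?s + ?N * ?s)"
    using ln_over_square_bounds(2)[OF N] N by (intro mult_right_mono) auto
  also have "\<dots> = 4 * ln ?N * (?s / ?N)" using N by (simp add: field_simps power2_eq_square)
  also have "?s / ?N = 1 / ?s" using N sqrt_divide_self_eq[of ?N] by (simp add: inverse_eq_divide)
  also have "1 / ?s = (1 / sqrt q) ^ d" by (simp add: real_sqrt_power power_one_over)
  also have "ln ?N = d * ln q" using q_ge_3 by (simp add: ln_realpow)
  finally show "expectation (\<lambda>\<omega>. \<bar>block d \<omega>\<bar>) \<le> 4 * ln q * (real d * (1 / sqrt q) ^ d)" by (simp add: mult_ac)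
qed

lemma block_0: "block 0 \<omega> = 0"
proof -
  have "prime_polys_deg 0 = ({} :: 'a poly set)" using prime_polysD(4) by (auto simp: prime_polys_deg_def)
  then show ?thesis by (simp add: block_def)
qed

lemma sqrt_q: "0 < 1 / sqrt q" "1 / sqrt q < 1"
  using q_ge_3 by auto

text \<open>By Tonelli the expected sum is finite, hence the sum is finite almost surely.\<close>

lemma AE_summable_block: "AE \<omega> in M. summable (\<lambda>d. \<bar>block d \<omega>\<bar>)"
proof -
  have sm: "summable (\<lambda>d. 4 * ln q * (real d * (1 / sqrt q) ^ d))"
  proof -
    have "summable (\<lambda>d. real (Suc d) * (1 / sqrt q) ^ d)"
      using geometric_deriv_sums[of "1 / sqrt q"] sqrt_q by (auto simp: sums_iff)
    then have "summable (\<lambda>d. real (Suc d) * (1 / sqrt q) ^ d - (1 / sqrt q) ^ d)"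
      using sqrt_q by (intro summable_diff summable_geometric) auto
    then show ?thesis by (intro summable_mult) (simp add: algebra_simps)
  qed
  have le: "(\<integral>\<^sup>+\<omega>. ennreal \<bar>block d \<omega>\<bar> \<partial>M) \<le> ennreal (4 * ln q * (real d * (1 / sqrt q) ^ d))" for d
  proof (cases "d \<ge> 1")
    case True
    have "(\<integral>\<^sup>+\<omega>. ennreal \<bar>block d \<omega>\<bar> \<partial>M) = ennreal (expectation (\<lambda>\<omega>. \<bar>block d \<omega>\<bar>))"
      using expectation_abs_block(1)[OF True] by (intro nn_integral_eq_integral) auto
    then show ?thesis using expectation_abs_block(2)[OF True] by (simp add: ennreal_leI)
  next
    case False
    then have "d = 0" by simp
    then show ?thesis by (simp add: block_0)
  qed
  have "(\<integral>\<^sup>+\<omega>. (\<Sum>d. ennreal \<bar>block d \<omega>\<bar>) \<partial>M) = (\<Sum>d. \<integral>\<^sup>+\<omega>. ennreal \<bar>block d \<omega>\<bar> \<partial>M)"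
    by (rule nn_integral_suminf) measurable
  also have "\<dots> \<le> (\<Sum>d. ennreal (4 * ln q * (real d * (1 / sqrt q) ^ d)))"
    by (intro suminf_le le) auto
  also have "\<dots> = ennreal (\<Sum>d. 4 * ln q * (real d * (1 / sqrt q) ^ d))"
    using sm sqrt_q q_ge_3 by (intro suminf_ennreal2) auto
  also have "\<dots> < \<infinity>" by simp
  finally have "(\<integral>\<^sup>+\<omega>. (\<Sum>d. ennreal \<bar>block d \<omega>\<bar>) \<partial>M) \<noteq> \<infinity>" by simp
  then have "AE \<omega> in M. (\<Sum>d. ennreal \<bar>block d \<omega>\<bar>) \<noteq> \<infinity>"
    by (intro nn_integral_PInf_AE) measurable
  then show ?thesis by eventually_elim (intro summable_suminf_not_top, auto)
qed

end

lemma sum_power_from_1: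
  fixes r :: real
  assumes "r \<noteq> 1"
  shows "(\<Sum>k\<in>{1..K}. r ^ k) = r / (1 - r) - r / (1 - r) * r ^ K"
proof (induction K)
  case (Suc K)
  define c where "c = r / (1 - r)"
  have "c * (1 - r) = r" using assms by (simp add: c_def)
  then have "r * r ^ K = (c - c * r) * r ^ K" by (simp add: right_diff_distrib)
  then have "c - c * r ^ K + r ^ Suc K = c - c * r ^ Suc K" by (simp add: algebra_simps)
  then show ?case using Suc by (simp add: c_def)
qed simp

text \<open>With r = x / N the difference is exactly a geometric tail, ln N * r / (1 - r) * r^K up
  to sign, and r / (1 - r) is at most 2 / N in modulus.\<close>

lemma truncated_local_factor:
  fixes N x :: real
  assumes N: "N \<ge> 3" and x: "x \<in> {1, -1, 0}"
  shows "\<bar>(\<Sum>k\<in>{1..K}. ln N * (x / N) ^ k) - ln N / (N\<^sup>2 - 1) * (N * x + x\<^sup>2)\<bar>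
    \<le> 2 * ln N / N * (1 / N) ^ K"
proof -
  define r where "r = x / N"
  have r1: "r \<noteq> 1" using N x by (auto simp: r_def)
  have N2: "N\<^sup>2 - 1 = (N - 1) * (N + 1)" by (simp add: power2_eq_square algebra_simps)
  have eq: "(N * x + x\<^sup>2) / (N\<^sup>2 - 1) = r / (1 - r)"
    unfolding N2 r_def using N x by (auto simp: divide_simps) (auto simp: algebra_simps)
  have bd: "\<bar>r / (1 - r)\<bar> \<le> 2 / N"
    unfolding r_def using N x by (auto simp: divide_simps)
  have rN: "\<bar>r\<bar> \<le> 1 / N" unfolding r_def using N x by auto
  have ln: "ln N \<ge> 0" using N by simp
  have "(\<Sum>k\<in>{1..K}. ln N * (x / N) ^ k) = ln N * (\<Sum>k\<in>{1..K}. r ^ k)"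
    by (simp add: sum_distrib_left r_def)
  also have "\<dots> = ln N * (r / (1 - r)) - ln N * (r / (1 - r) * r ^ K)"
    unfolding sum_power_from_1[OF r1] by (rule right_diff_distrib)
  finally have "(\<Sum>k\<in>{1..K}. ln N * (x / N) ^ k) - ln N * ((N * x + x\<^sup>2) / (N\<^sup>2 - 1)) = - (ln N * (r / (1 - r) * r ^ K))"
    unfolding eq by simp
  then have "\<bar>(\<Sum>k\<in>{1..K}. ln N * (x / N) ^ k) - ln N / (N\<^sup>2 - 1) * (N * x + x\<^sup>2)\<bar>
      = ln N * (\<bar>r / (1 - r)\<bar> * \<bar>r\<bar> ^ K)"
    using ln by (simp add: abs_mult power_abs)
  also have "\<dots> \<le> ln N * (2 / N * (1 / N) ^ K)"
    using bd rN ln N by (intro mult_left_mono mult_mono power_mono) auto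
  also have "\<dots> = 2 * ln N / N * (1 / N) ^ K" by simp
  finally show ?thesis .
qed

lemma (in prob_space) char_distr_tendsto:
  fixes S :: "nat \<Rightarrow> 'a \<Rightarrow> real"
  assumes [measurable]: "\<And>n. S n \<in> borel_measurable M" "S' \<in> borel_measurable M"
    and lim: "AE \<omega> in M. (\<lambda>n. S n \<omega>) \<longlonglongrightarrow> S' \<omega>"
  shows "(\<lambda>n. char (distr M borel (S n)) u) \<longlonglongrightarrow> char (distr M borel S') u"
proof -
  have "(\<lambda>n. CLINT \<omega>|M. iexp (u * S n \<omega>)) \<longlonglongrightarrow> (CLINT \<omega>|M. iexp (u * S' \<omega>))"
  proof (rule integral_dominated_convergence[where w="\<lambda>_. 1"])
    show "AE \<omega> in M. (\<lambda>n. iexp (u * S n \<omega>)) \<longlonglongrightarrow> iexp (u * S' \<omega>)"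
      using lim by eventually_elim (intro tendsto_intros)
  qed auto
  then show ?thesis by (simp add: char_def integral_distr)
qed

context random_characters begin

text \<open>The error consists of the tails of the local series cut off at \<open>m div d\<close>.
  For each d there are at most q^d / d primes, with tails at most 2 ln N / N * q^(-m/2), a total of
  at most 2 ln q * q^(-m/2); the factor m counts the degrees.\<close>

lemma sum_mangoldt_approx:
  assumes X: "\<And>P. P \<in> prime_polys \<Longrightarrow> X P \<omega> \<in> {1, -1, 0}"
  shows "\<bar>(\<Sum>f | f \<in> monic_polys \<and> degree f \<le> m. poly_mangoldt f / poly_norm f * mult_ext X f \<omega>)
      - (\<Sum>d\<in>{1..m}. block d \<omega>)\<bar> \<le> 2 * ln q * (real m * (1 / sqrt q) ^ m)"
proof -
  let ?A = "\<lambda>P d. (\<Sum>k\<in>{1..m div d}. ln (poly_norm P) * (X P \<omega> / poly_norm P) ^ k) - Y P \<omega>"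
  have bd: "\<bar>\<Sum>P\<in>prime_polys_deg d. ?A P d\<bar> \<le> 2 * ln q * (1 / sqrt q) ^ m" if d: "d \<in> {1..m}" for d
  proof -
    let ?F = "prime_polys_deg d :: 'a poly set"
    have N: "q ^ d \<ge> 3" using q_power_ge_3 d by simp
    have lnq: "ln q \<ge> 0" using q_ge_3 by simp
    \<comment> \<open>The number d * (m div d) exceeds m - d and is at least d, hence at least m /
      2; this is why \<open>sqrt q\<close> appears in place of \<open>q\<close>.\<close>
    have pw: "(1 / q ^ d) ^ (m div d) \<le> (1 / sqrt q) ^ m"
    proof -
      have "0 < d" using d by simp
      then have "m < d * (m div d) + d" using mult_div_mod_eq[of d m] mod_less_divisor[of d m] by linarith
      moreover have "d * 1 \<le> d * (m div d)" using d \<open>0 < d\<close> by (intro mult_left_mono) (auto simp: less_eq_div_iff_mult_less_eq)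
      ultimately have le: "m \<le> 2 * (d * (m div d))" by linarith
      have "(1 / q ^ d) ^ (m div d) = ((1 / sqrt q)\<^sup>2) ^ (d * (m div d))"
        using q_ge_3 by (simp add: power_divide power_mult)
      also have "\<dots> = (1 / sqrt q) ^ (2 * (d * (m div d)))" by (simp add: power_mult)
      also have "\<dots> \<le> (1 / sqrt q) ^ m" using le sqrt_q by (intro power_decreasing) auto
      finally show ?thesis .
    qed
    have "\<bar>?A P d\<bar> \<le> 2 * ln (q ^ d) / q ^ d * (1 / sqrt q) ^ m" if P: "P \<in> ?F" for P
    proof -
      have "\<bar>?A P d\<bar> \<le> 2 * ln (q ^ d) / q ^ d * (1 / q ^ d) ^ (m div d)"
        using truncated_local_factor[OF N, of "X P \<omega>" "m div d"] X[OF prime_polys_degD(1)[OF P]]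
        unfolding Y_def coef_def prime_polys_degD(2)[OF P] by blast
      also have "\<dots> \<le> 2 * ln (q ^ d) / q ^ d * (1 / sqrt q) ^ m"
        using N pw by (intro mult_left_mono) auto
      finally show ?thesis .
    qed
    then have "(\<Sum>P\<in>?F. \<bar>?A P d\<bar>) \<le> (\<Sum>P\<in>?F. 2 * ln (q ^ d) / q ^ d * (1 / sqrt q) ^ m)"
      by (rule sum_mono)
    also have "\<dots> = (real (card ?F) * d) * (2 * ln q / q ^ d * (1 / sqrt q) ^ m)"
      using q_ge_3 by (simp add: ln_realpow)
    also have "\<dots> \<le> q ^ d * (2 * ln q / q ^ d * (1 / sqrt q) ^ m)"
      using lnq N sqrt_q d by (intro mult_right_mono card_prime_polys_deg_le) auto
    also have "\<dots> = 2 * ln q * (1 / sqrt q) ^ m" using N by simp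
    finally show ?thesis using sum_abs[of "\<lambda>P. ?A P d" ?F] by linarith
  qed
  have "(\<Sum>f | f \<in> monic_polys \<and> degree f \<le> m. poly_mangoldt f / poly_norm f * mult_ext X f \<omega>)
      - (\<Sum>d\<in>{1..m}. block d \<omega>) = (\<Sum>d\<in>{1..m}. \<Sum>P\<in>prime_polys_deg d. ?A P d)"
    unfolding sum_mangoldt_eq block_def by (simp add: sum_subtractf)
  also have "\<bar>\<dots>\<bar> \<le> (\<Sum>d\<in>{1..m}. \<bar>\<Sum>P\<in>prime_polys_deg d. ?A P d\<bar>)"
    by (rule sum_abs)
  also have "\<dots> \<le> (\<Sum>d\<in>{1..m}. 2 * ln q * (1 / sqrt q) ^ m)"
    by (rule sum_mono) (rule bd)
  also have "\<dots> = 2 * ln q * (real m * (1 / sqrt q) ^ m)" by simp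
  finally show ?thesis .
qed

text \<open>The two kinds of partial sums approach each other by \<open>sum_mangoldt_approx\<close>,
  so convergence of the block sums makes the \<open>lim\<close> in \<open>neg_log_deriv_L\<close> a
  genuine limit almost surely.\<close>

lemma AE_neg_log_deriv_L:
  "AE \<omega> in M. (\<lambda>m. \<Sum>d\<le>m. block d \<omega>) \<longlonglongrightarrow> neg_log_deriv_L X \<omega>"
proof -
  have "AE \<omega> in M. \<forall>P\<in>prime_polys. X P \<omega> \<in> {1, -1, 0}"
    using AE_X_values countable_prime_polys by (intro AE_ball_countable') auto
  then show ?thesis using AE_summable_block
  proof eventually_elim
    case (elim \<omega>)
    let ?a = "\<lambda>m. \<Sum>f | f \<in> monic_polys \<and> degree f \<le> m. poly_mangoldt f / poly_norm f * mult_ext X f \<omega>"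
    have "summable (\<lambda>d. block d \<omega>)" using elim(2) by (rule summable_rabs_cancel)
    then have block: "(\<lambda>m. \<Sum>d\<le>m. block d \<omega>) \<longlonglongrightarrow> (\<Sum>d. block d \<omega>)" by (rule summable_LIMSEQ')
    have "(\<lambda>m. 2 * ln q * (real m * (1 / sqrt q) ^ m)) \<longlonglongrightarrow> 2 * ln q * 0"
      using sqrt_q by (intro tendsto_mult tendsto_const powser_times_n_limit_0) auto
    then have lim0: "(\<lambda>m. 2 * ln q * (real m * (1 / sqrt q) ^ m)) \<longlonglongrightarrow> 0" by simp
    have sums: "(\<Sum>d\<in>{1..m}. block d \<omega>) = (\<Sum>d\<le>m. block d \<omega>)" for m
      by (rule sum.mono_neutral_left) (auto simp: not_less_eq_eq block_0)
    have "(\<lambda>m. ?a m - (\<Sum>d\<le>m. block d \<omega>)) \<longlonglongrightarrow> 0"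
      by (rule Lim_null_comparison[OF always_eventually lim0])
         (use elim(1) sum_mangoldt_approx[of \<omega>] sums in auto)
    from tendsto_add[OF this block] have "?a \<longlonglongrightarrow> (\<Sum>d. block d \<omega>)" by simp
    then have "neg_log_deriv_L X \<omega> = (\<Sum>d. block d \<omega>)"
      unfolding neg_log_deriv_L_def by (rule limI)
    then show ?case using block by simp
  qed
qed

lemma neg_log_deriv_L_measurable [measurable]: "neg_log_deriv_L X \<in> borel_measurable M"
proof -
  have "mult_ext X f \<in> borel_measurable M" for f :: "'a poly"
    unfolding mult_ext_def by (intro borel_measurable_prod borel_measurable_power) auto
  then show ?thesis unfolding neg_log_deriv_L_def
    by (intro borel_measurable_lim_metric borel_measurable_sum borel_measurable_times) auto
qed

end

section \<open>Decay of the characteristic functions\<close>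

context random_characters begin

definition char_block :: "nat \<Rightarrow> real \<Rightarrow> complex"
  where "char_block d u = (\<Prod>P\<in>prime_polys_deg d. char (distr M borel (Y P)) u)"

text \<open>Here the independence of the \<open>Y P\<close> enters. For a single degree the lemma
  identifies \<open>char_block d\<close> as the characteristic function of
  \<open>block d\<close>.\<close>

lemma char_sum_block:
  assumes A: "finite A"
  shows "char (distr M borel (\<lambda>\<omega>. \<Sum>d\<in>A. block d \<omega>)) u = (\<Prod>d\<in>A. char_block d u)"
proof -
  let ?F = "\<Union>d\<in>A. prime_polys_deg d :: 'a poly set"
  have disj: "\<forall>i\<in>A. \<forall>j\<in>A. i \<noteq> j \<longrightarrow> prime_polys_deg i \<inter> (prime_polys_deg j :: 'a poly set) = {}"
    unfolding prime_polys_deg_def by blast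
  have "(\<lambda>\<omega>. \<Sum>d\<in>A. block d \<omega>) = (\<lambda>\<omega>. \<Sum>P\<in>?F. Y P \<omega>)"
    unfolding block_def using A disj by (subst sum.UNION_disjoint) (auto simp: finite_prime_polys_deg)
  moreover have "indep_vars (\<lambda>_. borel) Y ?F"
    by (rule indep_vars_subset[OF indep_Y]) (auto dest: prime_polys_degD)
  ultimately have "char (distr M borel (\<lambda>\<omega>. \<Sum>d\<in>A. block d \<omega>)) u = (\<Prod>P\<in>?F. char (distr M borel (Y P)) u)"
    by (simp add: char_distr_sum)
  also have "\<dots> = (\<Prod>d\<in>A. char_block d u)"
    unfolding char_block_def using A disj by (subst prod.UNION_disjoint) (auto simp: finite_prime_polys_deg)
  finally show ?thesis .
qed

lemma cmod_char_block_le_1: "cmod (char_block d u) \<le> 1"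
proof -
  have "cmod (char (distr M borel (Y P)) u) \<le> 1" if "P \<in> prime_polys_deg d" for P
    using that by (intro real_distribution.cmod_char_le_1 real_distribution_distr) (auto dest: prime_polys_degD)
  then show ?thesis unfolding char_block_def prod_norm[symmetric] by (intro prod_le_1) auto
qed

lemma ln_q: "ln q \<ge> 1"
proof -
  have "exp 1 \<le> q" using exp_le q_ge_3 by linarith
  then show ?thesis using q_ge_3 by (subst ln_ge_iff) auto
qed

text \<open>Multiply the bounds of \<open>char_Y_bound\<close>. There are at least N / (6 j) primes,
  and |\<theta>| is at least |u| * ln N / N with ln N = 3 j ln q, so the number of primes times
  \<theta>^2 is at least u^2 / (2 N). The factor 1/8 turns this into u^2 / (16 N).\<close>

lemma cmod_char_block_decay:
  assumes j: "j \<ge> 1" and u: "\<bar>u\<bar> \<le> q ^ (2 * j) / 12"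
  shows "cmod (char_block (3 * j) u) \<le> exp (- u\<^sup>2 / (16 * q ^ (3 * j)))"
proof -
  let ?F = "prime_polys_deg (3 * j) :: 'a poly set"
  let ?N = "q ^ (3 * j)"
  let ?c = "ln ?N / (?N\<^sup>2 - 1)"
  let ?\<theta> = "u * (?c * ?N)"
  have N: "?N \<ge> 3" using q_power_ge_3 j by simp
  define y where "y = q ^ j"
  have y: "y > 0" using q_ge_3 by (simp add: y_def)
  have Ny: "?N = y * y\<^sup>2" "q ^ (2 * j) = y\<^sup>2"
    by (simp_all add: y_def power_mult mult.commute[of _ j] flip: power_Suc)
  have lnN: "ln ?N = 3 * j * ln q" using q_ge_3 by (simp add: ln_realpow)
  have "ln y \<le> y" using y ln_le_minus_one[of y] by linarith
  then have lny: "ln ?N \<le> 3 * y" unfolding lnN using q_ge_3 by (simp add: y_def ln_realpow)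
  have cN: "?c * ?N \<le> 2 * ln ?N / ?N"
  proof -
    have "?c * ?N \<le> 2 * ln ?N / ?N\<^sup>2 * ?N" using ln_over_square_bounds(2)[OF N] N by (intro mult_right_mono) auto
    also have "\<dots> = 2 * ln ?N / ?N" using N by (simp add: power2_eq_square)
    finally show ?thesis .
  qed
  have cN0: "0 \<le> ?c * ?N" using ln_over_square_bounds(1)[OF N] N by (intro mult_nonneg_nonneg) auto
  \<comment> \<open>From ln N <= 3 y one gets c N <= 6 / y^2; the 12 in the range of
    \<open>u\<close> then brings |\<theta>| down to 1/2.\<close>
  have th1: "\<bar>?\<theta>\<bar> \<le> 1"
  proof -
    have "2 * ln ?N / ?N \<le> 2 * (3 * y) / ?N" using lny N by (intro divide_right_mono mult_left_mono) auto
    with cN have "?c * ?N \<le> 2 * (3 * y) / ?N" by (rule order_trans)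
    also have "\<dots> = 6 / y\<^sup>2" using y unfolding Ny by simp
    finally have "?c * ?N \<le> 6 / y\<^sup>2" .
    then have "\<bar>u\<bar> * (?c * ?N) \<le> (y\<^sup>2 / 12) * (6 / y\<^sup>2)"
      using u cN0 y unfolding Ny(2) by (intro mult_mono) auto
    also have "\<dots> \<le> 1" using y by simp
    finally show ?thesis using cN0 by (simp only: abs_mult[of u] abs_of_nonneg)
  qed
  have "cmod (char_block (3 * j) u) = (\<Prod>P\<in>?F. cmod (char (distr M borel (Y P)) u))"
    unfolding char_block_def prod_norm[symmetric] ..
  also have "\<dots> \<le> (\<Prod>P\<in>?F. exp (- ?\<theta>\<^sup>2 / 8))"
  proof (intro prod_mono conjI norm_ge_zero)
    fix P assume P: "P \<in> ?F"
    have "coef P * poly_norm P = ?c * ?N" unfolding coef_def prime_polys_degD(2)[OF P] ..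
    then show "cmod (char (distr M borel (Y P)) u) \<le> exp (- ?\<theta>\<^sup>2 / 8)"
      using char_Y_bound[OF prime_polys_degD(1)[OF P], of u] th1 by simp
  qed
  also have "\<dots> = exp (real (card ?F) * (- ?\<theta>\<^sup>2 / 8))" by (simp only: prod_constant exp_of_nat_mult)
  also have "\<dots> \<le> exp (- u\<^sup>2 / (16 * ?N))"
  proof -
    have "ln ?N / ?N \<le> ?c * ?N"
    proof -
      have "ln ?N / ?N = ln ?N / ?N\<^sup>2 * ?N" using N by (simp add: power2_eq_square)
      also have "\<dots> \<le> ?c * ?N"
        using N power_mono[OF N, of 2] q_ge_3
        by (intro mult_right_mono divide_left_mono mult_pos_pos) auto
      finally show ?thesis .
    qed
    then have "(ln ?N / ?N)\<^sup>2 \<le> (?c * ?N)\<^sup>2" using N by (intro power_mono) auto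
    then have t: "u\<^sup>2 * (ln ?N / ?N)\<^sup>2 \<le> ?\<theta>\<^sup>2" unfolding power_mult_distrib[of u] by (rule mult_left_mono) simp
    have "u\<^sup>2 / (2 * ?N) \<le> real (card ?F) * (u\<^sup>2 * (ln ?N / ?N)\<^sup>2)"
    proof -
      have jl: "1 \<le> real (3 * j) * (ln q)\<^sup>2"
      proof -
        have "1 * 1 \<le> real (3 * j) * (ln q)\<^sup>2"
          using j ln_q by (intro mult_mono) (auto simp: one_le_power)
        then show ?thesis by simp
      qed
      have "?N / 2 \<le> real (card ?F) * real (3 * j)" using card_prime_polys_deg_ge[of "3 * j"] j by simp
      then have "?N / 2 * 1 \<le> (real (card ?F) * real (3 * j)) * (real (3 * j) * (ln q)\<^sup>2)"
        using jl N by (intro mult_mono) auto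
      also have "\<dots> = real (card ?F) * (ln ?N)\<^sup>2"
        unfolding lnN by (simp add: power2_eq_square)
      finally have "(u\<^sup>2 / ?N\<^sup>2) * (?N / 2) \<le> (u\<^sup>2 / ?N\<^sup>2) * (real (card ?F) * (ln ?N)\<^sup>2)"
        by (intro mult_left_mono) auto
      moreover have "(a / n\<^sup>2) * (n / 2) = a / (2 * n)" if "n \<ge> 3" for a n :: real
        using that by (simp add: power2_eq_square)
      moreover have "(a / n\<^sup>2) * (k * l\<^sup>2) = k * (a * (l / n)\<^sup>2)" for a n k l :: real
        by (simp add: power_divide)
      ultimately show ?thesis using N by (simp only:)
    qed
    also have "\<dots> \<le> real (card ?F) * ?\<theta>\<^sup>2" using t by (intro mult_left_mono) auto
    finally show ?thesis by simp
  qed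
  finally show ?thesis .
qed

text \<open>The degree is adapted to \<open>u\<close>: it is 3 J for the least J with |u| <= q^(2J)
  / 12. Then |u| is also bounded below by a multiple of q^(2J), so the block is at most exp (- b y),
  where y = q^J has order sqrt |u|. This beats every power of \<open>u\<close>.\<close>

lemma cmod_char_block_bound:
  "\<exists>K. \<forall>u. \<exists>d. 3 dvd d \<and> cmod (char_block d u) \<le> K / (1 + u\<^sup>2)"
proof -
  \<comment> \<open>Minimality of J gives |u| >= y^2 / (12 q^2), and therefore u^2 / (16 y^3) >= b
    y.\<close>
  define b where "b = 1 / (12\<^sup>2 * 16 * q ^ 4)"
  have b: "b > 0" using q_ge_3 by (simp add: b_def)
  \<comment> \<open>48 is 24 from exp z >= z^4 / 4!, times 2 from y^4 >= (1 + u^2) / 2. The summand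
    2 covers |u| <= 1/12.\<close>
  define K where "K = 48 / b ^ 4 + 2"
  have "\<exists>d. 3 dvd d \<and> cmod (char_block d u) \<le> K / (1 + u\<^sup>2)" for u
  proof (cases "\<bar>u\<bar> \<le> 1 / 12")
    case True
    then have "u\<^sup>2 \<le> 1" by (simp add: abs_square_le_1)
    then have "1 \<le> 2 / (1 + u\<^sup>2)" by (simp add: add_pos_nonneg field_simps)
    also have "\<dots> \<le> K / (1 + u\<^sup>2)" using b by (intro divide_right_mono) (auto simp: K_def)
    finally show ?thesis using cmod_char_block_le_1[of 3 u] by (intro exI[of _ 3]) auto
  next
    case False
    define J where "J = (LEAST j. \<bar>u\<bar> \<le> q ^ (2 * j) / 12)"
    have "\<exists>j. \<bar>u\<bar> \<le> q ^ (2 * j) / 12"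
    proof -
      obtain n where n: "12 * \<bar>u\<bar> < q ^ n" using real_arch_pow[of q "12 * \<bar>u\<bar>"] q_ge_3 by auto
      have "q ^ n \<le> q ^ (2 * n)" using q_ge_3 by (intro power_increasing) auto
      then show ?thesis using n by (intro exI[of _ n]) simp
    qed
    then have J: "\<bar>u\<bar> \<le> q ^ (2 * J) / 12" unfolding J_def by (rule LeastI_ex)
    then have J1: "J \<ge> 1" using False by (cases J) auto
    have Jm: "q ^ (2 * (J - 1)) / 12 < \<bar>u\<bar>"
      using not_less_Least[of "J - 1" "\<lambda>j. \<bar>u\<bar> \<le> q ^ (2 * j) / 12"] J1 unfolding J_def by linarith
    define y where "y = q ^ J"
    have y: "y \<ge> 3" unfolding y_def using J1 by (rule q_power_ge_3)
    have y2: "q ^ (2 * J) = y\<^sup>2" "q ^ (3 * J) = y ^ 3" by (simp_all add: y_def power_mult mult.commute[of _ J])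
    have ym: "q ^ (2 * (J - 1)) = y\<^sup>2 / q\<^sup>2"
    proof -
      have "q ^ (2 * (J - 1)) * q\<^sup>2 = q ^ (2 * (J - 1) + 2)" by (rule power_add[symmetric])
      also have "2 * (J - 1) + 2 = 2 * J" using J1 by simp
      finally show ?thesis using q_ge_3 y2 by (simp add: field_simps)
    qed
    have low: "(y\<^sup>2 / q\<^sup>2 / 12)\<^sup>2 \<le> u\<^sup>2"
    proof -
      have "(y\<^sup>2 / q\<^sup>2 / 12)\<^sup>2 \<le> \<bar>u\<bar>\<^sup>2" using Jm unfolding ym by (intro power_mono) auto
      then show ?thesis by simp
    qed
    have up: "u\<^sup>2 \<le> y ^ 4"
    proof -
      have "\<bar>u\<bar>\<^sup>2 \<le> (y\<^sup>2)\<^sup>2" using J unfolding y2 by (intro power_mono) auto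
      then show ?thesis by simp
    qed
    have "b * y = (y\<^sup>2 / q\<^sup>2 / 12)\<^sup>2 / (16 * y ^ 3)"
      using y q_ge_3 by (simp add: b_def field_simps eval_nat_numeral)
    also have "\<dots> \<le> u\<^sup>2 / (16 * y ^ 3)" using low y by (intro divide_right_mono) auto
    finally have b_y: "b * y \<le> u\<^sup>2 / (16 * y ^ 3)" .
    have exp4: "z ^ 4 / 24 \<le> exp z" if "z \<ge> 0" for z :: real
    proof -
      have "z ^ 4 / 24 \<le> (\<Sum>n<5. z ^ n / fact n)" using that by (simp add: eval_nat_numeral)
      also have "\<dots> = (\<Sum>n<5. z ^ n /\<^sub>R fact n)" by (simp add: divide_inverse mult.commute)
      also have "\<dots> \<le> exp z"
        unfolding exp_def using that summable_exp_generic[of z]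
        by (intro sum_le_suminf) simp_all
      finally show ?thesis .
    qed
    have y4: "1 \<le> y ^ 4" using y by (intro one_le_power) auto
    have "cmod (char_block (3 * J) u) \<le> exp (- u\<^sup>2 / (16 * y ^ 3))"
      using cmod_char_block_decay[OF J1 J] unfolding y2 .
    also have "\<dots> \<le> exp (- (b * y))" using b_y by simp
    also have "\<dots> = 1 / exp (b * y)" by (simp add: exp_minus inverse_eq_divide)
    also have "\<dots> \<le> 1 / ((b * y) ^ 4 / 24)"
      using exp4[of "b * y"] b y by (intro divide_left_mono) auto
    also have "\<dots> = (24 / b ^ 4) / y ^ 4" by (simp add: power_mult_distrib)
    also have "\<dots> \<le> (24 / b ^ 4) / ((1 + u\<^sup>2) / 2)"
    proof (rule divide_left_mono)
      show "(1 + u\<^sup>2) / 2 \<le> y ^ 4" using up y4 by simp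
    qed (use b y in \<open>auto intro!: mult_pos_pos add_pos_nonneg\<close>)
    also have "\<dots> = (48 / b ^ 4) / (1 + u\<^sup>2)" by simp
    also have "\<dots> \<le> K / (1 + u\<^sup>2)" by (intro divide_right_mono) (auto simp: K_def)
    finally show ?thesis by (intro exI[of _ "3 * J"]) simp
  qed
  then show ?thesis by blast
qed

end

section \<open>Positivity of the density\<close>

text \<open>Partial sums start at 0, rise in steps of at most \<open>e\<close> and reach
  \<open>t\<close>, so one of them lies within \<open>e\<close> of \<open>t\<close>.\<close>

lemma subset_sum_approx:
  fixes a :: "'b \<Rightarrow> real"
  assumes "finite F" "\<And>i. i \<in> F \<Longrightarrow> 0 \<le> a i \<and> a i \<le> e" "0 \<le> t" "t \<le> sum a F" "0 \<le> e"
  shows "\<exists>G\<subseteq>F. \<bar>sum a G - t\<bar> \<le> e"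
  using assms
proof (induction F arbitrary: t rule: finite_induct)
  case empty
  then show ?case by auto
next
  case (insert i F)
  show ?case
  proof (cases "t \<le> sum a F")
    case True
    then obtain G where "G \<subseteq> F" "\<bar>sum a G - t\<bar> \<le> e" using insert by (metis insert_iff)
    then show ?thesis by blast
  next
    case False
    then have "\<bar>sum a (insert i F) - t\<bar> \<le> e" using insert.prems(1)[of i] insert.prems(3) insert.hyps by simp
    then show ?thesis by blast
  qed
qed

lemma integrable_inverse_1_plus_square_lborel:
  "integrable lborel (\<lambda>u::real. K / (1 + u\<^sup>2))"
proof -
  have "integrable lborel (\<lambda>u::real. inverse (1 + u\<^sup>2))"
    using integrable_inverse_1_plus_square by (simp add: set_integrable_def)
  then have "integrable lborel (\<lambda>u::real. K * inverse (1 + u\<^sup>2))" by (rule integrable_mult_right)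
  then show ?thesis by (simp add: divide_inverse)
qed

section \<open>Splitting \<open>Z\<close> into the finite part \<open>W m\<close> and a
  remainder\<close>

context random_characters begin

abbreviation Z :: "'w \<Rightarrow> real" where "Z \<equiv> neg_log_deriv_L X"

definition W :: "nat \<Rightarrow> 'w \<Rightarrow> real"
  where "W m \<omega> = (\<Sum>d | d \<le> m \<and> \<not> 3 dvd d. block d \<omega>)"

text \<open>Almost surely the limit of \<open>W m\<close>, so that \<open>Z - W_inf\<close> is the
  sum of the blocks of degree divisible by 3. Its law is the limit of the laws of the
  remainders.\<close>

definition W_inf :: "'w \<Rightarrow> real"
  where "W_inf \<omega> = (\<Sum>d. if 3 dvd d then 0 else block d \<omega>)"

lemma W_measurable [measurable]: "W m \<in> borel_measurable M"
  unfolding W_def by measurable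

lemma W_inf_measurable [measurable]: "W_inf \<in> borel_measurable M"
  unfolding W_inf_def by measurable

lemma AE_W_tendsto: "AE \<omega> in M. (\<lambda>m. W m \<omega>) \<longlonglongrightarrow> W_inf \<omega>"
  using AE_summable_block
proof eventually_elim
  case (elim \<omega>)
  let ?f = "\<lambda>d. if 3 dvd d then 0 else block d \<omega>"
  have "summable (\<lambda>d. \<bar>?f d\<bar>)" by (rule summable_comparison_test[OF _ elim]) auto
  then have "summable ?f" by (rule summable_rabs_cancel)
  then have "(\<lambda>m. \<Sum>d\<le>m. ?f d) \<longlonglongrightarrow> W_inf \<omega>" unfolding W_inf_def by (rule summable_LIMSEQ')
  moreover have "(\<Sum>d\<le>m. ?f d) = W m \<omega>" for m
    unfolding W_def by (rule sum.mono_neutral_cong_right) auto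
  ultimately show ?case by simp
qed

lemma char_Z_tendsto: "(\<lambda>m. \<Prod>d\<le>m. char_block d u) \<longlonglongrightarrow> char (distr M borel Z) u"
  using char_distr_tendsto[OF _ _ AE_neg_log_deriv_L, of u] by (simp add: char_sum_block)

lemma char_remainder_tendsto:
  "(\<lambda>n. \<Prod>d\<in>{..n} - {d. d \<le> m \<and> \<not> 3 dvd d}. char_block d u) \<longlonglongrightarrow> char (distr M borel (\<lambda>\<omega>. Z \<omega> - W m \<omega>)) u"
proof -
  let ?B = "{d. d \<le> m \<and> \<not> 3 dvd d}"
  let ?S = "\<lambda>n \<omega>. \<Sum>d\<in>{..n} - ?B. block d \<omega>"
  have "AE \<omega> in M. (\<lambda>n. ?S n \<omega>) \<longlonglongrightarrow> Z \<omega> - W m \<omega>"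
    using AE_neg_log_deriv_L
  proof eventually_elim
    case (elim \<omega>)
    then have "(\<lambda>n. (\<Sum>d\<le>n. block d \<omega>) - W m \<omega>) \<longlonglongrightarrow> Z \<omega> - W m \<omega>" by (intro tendsto_intros)
    moreover have "eventually (\<lambda>n. (\<Sum>d\<le>n. block d \<omega>) - W m \<omega> = ?S n \<omega>) sequentially"
      using eventually_ge_at_top[of m]
      by eventually_elim (auto simp: W_def intro!: sum_diff[symmetric])
    ultimately show ?case by (rule Lim_transform_eventually)
  qed
  then have "(\<lambda>n. char (distr M borel (?S n)) u) \<longlonglongrightarrow> char (distr M borel (\<lambda>\<omega>. Z \<omega> - W m \<omega>)) u"
    by (intro char_distr_tendsto) measurable
  then show ?thesis by (simp add: char_sum_block)
qed

text \<open>Finite products over degrees split, and both factors pass to the limit. This is the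
  independence of \<open>W m\<close> and \<open>Z - W m\<close> in the form that
  \<open>char_density_mult\<close> takes.\<close>

lemma char_Z_split:
  "char (distr M borel Z) u = char (distr M borel (W m)) u * char (distr M borel (\<lambda>\<omega>. Z \<omega> - W m \<omega>)) u"
proof -
  let ?B = "{d. d \<le> m \<and> \<not> 3 dvd d}"
  have W: "char (distr M borel (W m)) u = (\<Prod>d\<in>?B. char_block d u)"
    unfolding W_def by (rule char_sum_block) simp
  have "(\<lambda>n. char (distr M borel (W m)) u * (\<Prod>d\<in>{..n} - ?B. char_block d u))
      \<longlonglongrightarrow> char (distr M borel (W m)) u * char (distr M borel (\<lambda>\<omega>. Z \<omega> - W m \<omega>)) u"
    by (intro tendsto_intros char_remainder_tendsto)
  moreover have "eventually (\<lambda>n. char (distr M borel (W m)) u * (\<Prod>d\<in>{..n} - ?B. char_block d u) = (\<Prod>d\<le>n. char_block d u)) sequentially"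
    using eventually_ge_at_top[of m]
  proof eventually_elim
    case (elim n)
    then have "?B \<subseteq> {..n}" by auto
    then show ?case unfolding W by (subst prod.subset_diff[of ?B "{..n}"]) (simp_all add: mult.commute)
  qed
  ultimately have "(\<lambda>n. \<Prod>d\<le>n. char_block d u)
      \<longlonglongrightarrow> char (distr M borel (W m)) u * char (distr M borel (\<lambda>\<omega>. Z \<omega> - W m \<omega>)) u"
    by (rule Lim_transform_eventually)
  then show ?thesis by (rule LIMSEQ_unique[OF char_Z_tendsto])
qed

lemma cmod_prod_char_block_le:
  assumes "finite A" "d \<in> A"
  shows "cmod (\<Prod>i\<in>A. char_block i u) \<le> cmod (char_block d u)"
proof -
  have "cmod (\<Prod>i\<in>A. char_block i u) = cmod (char_block d u) * (\<Prod>i\<in>A - {d}. cmod (char_block i u))"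
    using assms by (simp add: prod.remove norm_mult prod_norm)
  also have "\<dots> \<le> cmod (char_block d u) * 1"
    by (intro mult_left_mono prod_le_1) (auto simp: cmod_char_block_le_1)
  finally show ?thesis by simp
qed

text \<open>\<open>W m\<close> never takes away a degree divisible by 3, so the factor
  \<open>char_block d\<close> stays in the product and the other factors have modulus at most 1. The
  bound is free of \<open>m\<close>: this is the uniformity of the decay.\<close>

lemma char_remainder_bound:
  assumes "3 dvd d"
  shows "cmod (char (distr M borel (\<lambda>\<omega>. Z \<omega> - W m \<omega>)) u) \<le> cmod (char_block d u)"
proof (rule LIMSEQ_le_const2[OF tendsto_norm[OF char_remainder_tendsto]])
  show "\<exists>N. \<forall>n\<ge>N. cmod (\<Prod>d\<in>{..n} - {d. d \<le> m \<and> \<not> 3 dvd d}. char_block d u) \<le> cmod (char_block d u)"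
    using assms by (intro exI[of _ d] allI impI cmod_prod_char_block_le) auto
qed

lemma char_remainder_limit:
  "(\<lambda>m. char (distr M borel (\<lambda>\<omega>. Z \<omega> - W m \<omega>)) u) \<longlonglongrightarrow> char (distr M borel (\<lambda>\<omega>. Z \<omega> - W_inf \<omega>)) u"
proof (rule char_distr_tendsto)
  show "AE \<omega> in M. (\<lambda>m. Z \<omega> - W m \<omega>) \<longlonglongrightarrow> Z \<omega> - W_inf \<omega>"
    using AE_W_tendsto by eventually_elim (intro tendsto_intros)
qed measurable

text \<open>For \<open>s\<close> = 1 or -1 the value of \<open>Y P\<close> at \<open>X P = s\<close>
  is \<open>s * weight s P\<close>, so the weight is its absolute value.\<close>

definition weight :: "real \<Rightarrow> 'a poly \<Rightarrow> real"
  where "weight s P = coef P * (poly_norm P + s)"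

lemma weight_bounds:
  assumes P: "P \<in> prime_polys_deg d" and d: "d \<ge> 1" and s: "s \<in> {1, -1::real}"
  shows "0 \<le> weight s P" "weight s P \<le> 4 * ln q * (real d * (1 / q) ^ d)" "ln q * d / (2 * q ^ d) \<le> weight s P"
proof -
  let ?N = "q ^ d"
  have N: "?N \<ge> 3" by (rule q_power_ge_3[OF d])
  have w: "weight s P = ln ?N / (?N\<^sup>2 - 1) * (?N + s)"
    unfolding weight_def coef_def prime_polys_degD(2)[OF P] ..
  have lnN: "ln ?N = d * ln q" using q_ge_3 by (simp add: ln_realpow)
  have lN: "ln ?N \<ge> 0" using N by simp
  show "0 \<le> weight s P" unfolding w using ln_over_square_bounds(1)[OF N] N s by (intro mult_nonneg_nonneg) auto
  have "weight s P \<le> (2 * ln ?N / ?N\<^sup>2) * (2 * ?N)"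
    unfolding w using ln_over_square_bounds[OF N] N s by (intro mult_mono) auto
  also have "\<dots> = 4 * ln ?N / ?N" using N by (simp add: power2_eq_square)
  finally show "weight s P \<le> 4 * ln q * (real d * (1 / q) ^ d)"
    unfolding lnN by (simp add: power_one_over mult_ac)
  have N2: "?N\<^sup>2 - 1 > 0" using power_mono[OF N, of 2] by simp
  have frac: "1 / (2 * n) \<le> (n + s) / (n\<^sup>2 - 1)" if "n \<ge> 3" for n :: real
  proof -
    have "n\<^sup>2 - 1 = (n - s) * (n + s)" using s by (auto simp: power2_eq_square algebra_simps)
    moreover have "n + s > 0" "n - s > 0" using that s by auto
    ultimately have "(n + s) / (n\<^sup>2 - 1) = 1 / (n - s)" by simp
    moreover have "1 / (2 * n) \<le> 1 / (n - s)" using that s by (intro divide_left_mono) auto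
    ultimately show ?thesis by simp
  qed
  have "ln ?N * (1 / (2 * ?N)) \<le> ln ?N * ((?N + s) / (?N\<^sup>2 - 1))"
    using frac[OF N] lN by (rule mult_left_mono)
  then show "ln q * d / (2 * q ^ d) \<le> weight s P" unfolding w by (simp add: lnN mult_ac)
qed

text \<open>At least q^d / (2 d) primes have weight at least d ln q / (2 q^d) each. The bound is the
  same for all degrees, so the weights have a divergent sum over any infinite set of
  degrees.\<close>

lemma sum_weight_ge:
  assumes d: "d \<ge> 1" and s: "s \<in> {1, -1::real}"
  shows "1 / 4 \<le> (\<Sum>P\<in>prime_polys_deg d. weight s P)"
proof -
  let ?F = "prime_polys_deg d :: 'a poly set"
  have q0: "q ^ d > 0" using q_ge_3 by simp
  have "1 / 4 \<le> ln q / 4" using ln_q by simp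
  also have "\<dots> = (q ^ d / 2) * (ln q / (2 * q ^ d))" using q0 by simp
  also have "\<dots> \<le> (real (card ?F) * d) * (ln q / (2 * q ^ d))"
    using card_prime_polys_deg_ge[OF d] ln_q q0 by (intro mult_right_mono) auto
  also have "\<dots> = (\<Sum>P\<in>?F. ln q * d / (2 * q ^ d))" by simp
  also have "\<dots> \<le> (\<Sum>P\<in>?F. weight s P)"
    using weight_bounds(3)[OF _ d s] by (intro sum_mono) auto
  finally show ?thesis .
qed

text \<open>\<open>W m\<close> depends on finitely many \<open>X P\<close>, so prescribing their
  values with positive probability yields an atom of \<open>W m\<close>.\<close>

lemma prob_pattern_pos:
  assumes F: "finite F" "F \<subseteq> prime_polys" and s: "\<And>P. P \<in> F \<Longrightarrow> s P \<in> {1, -1, 0}"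
  shows "prob {\<omega> \<in> space M. \<forall>P\<in>F. X P \<omega> = s P} > 0"
proof (cases "F = {}")
  case True
  then show ?thesis by (simp add: prob_space)
next
  case False
  have "{\<omega> \<in> space M. \<forall>P\<in>F. X P \<omega> = s P} = (\<Inter>P\<in>F. X P -` {s P} \<inter> space M)" using False by auto
  then have "prob {\<omega> \<in> space M. \<forall>P\<in>F. X P \<omega> = s P} = (\<Prod>P\<in>F. prob (X P -` {s P} \<inter> space M))"
    using indep_varsD[OF indep_X False F, of "\<lambda>P. {s P}"] by simp
  moreover have "(\<Prod>P\<in>F. prob (X P -` {s P} \<inter> space M)) > 0"
  proof (rule prod_pos)
    fix P assume P: "P \<in> F"
    then have P': "P \<in> prime_polys" using F by auto
    have eq: "X P -` {v} \<inter> space M = {\<omega> \<in> space M. X P \<omega> = v}" for v by auto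
    have N: "poly_norm P > 0" by (rule poly_norm_pos)
    show "0 < prob (X P -` {s P} \<inter> space M)"
      using s[OF P] N unfolding eq
      by (auto simp: prob_X_1[OF P'] prob_X_m1[OF P'] prob_X_0[OF P'] intro!: divide_pos_pos add_pos_pos)
  qed
  ultimately show ?thesis by simp
qed

text \<open>Take degrees so large that all weights are at most \<open>e\<close>, and enough of them
  for the weights to reach |t|. Some subset sum is within \<open>e\<close> of |t|; giving
  \<open>X P\<close> the sign of \<open>t\<close> on that subset and 0 elsewhere realizes
  it.\<close>

lemma ex_atom_W:
  assumes e: "e > 0"
  shows "\<exists>m\<ge>k. \<exists>w. \<bar>w - t\<bar> \<le> e \<and> measure (distr M borel (W m)) {w} > 0"
proof -
  define \<sigma> :: real where "\<sigma> = (if t \<ge> 0 then 1 else -1)"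
  have \<sigma>: "\<sigma> \<in> {1, -1}" "t = \<sigma> * \<bar>t\<bar>" "\<bar>\<sigma>\<bar> = 1" "\<sigma>\<^sup>2 = 1" by (auto simp: \<sigma>_def)
  have "(\<lambda>d. 4 * ln q * (real d * (1 / q) ^ d)) \<longlonglongrightarrow> 4 * ln q * 0"
    using q_ge_3 by (intro tendsto_mult tendsto_const powser_times_n_limit_0) auto
  then have "eventually (\<lambda>d. 4 * ln q * (real d * (1 / q) ^ d) < e) sequentially"
    using e by (intro order_tendstoD(2)) auto
  then obtain m0 where m0: "\<And>d. d \<ge> m0 \<Longrightarrow> 4 * ln q * (real d * (1 / q) ^ d) < e"
    unfolding eventually_sequentially by blast
  obtain L :: nat where L: "4 * \<bar>t\<bar> \<le> L" using real_arch_simple by blast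
  \<comment> \<open>Degrees congruent to 1 modulo 3 avoid the reserved ones. Each of the
    \<open>L\<close> degrees contributes at least 1/4 by \<open>sum_weight_ge\<close>, whence the
    choice of \<open>L\<close>.\<close>
  define A where "A = (\<lambda>i. 3 * i + 1) ` {m0..<m0 + L}"
  have A: "finite A" "card A = L" "\<And>d. d \<in> A \<Longrightarrow> d \<ge> m0 \<and> d \<ge> 1 \<and> \<not> 3 dvd d"
    by (auto simp: A_def card_image inj_on_def, presburger)
  define m where "m = max k (3 * (m0 + L))"
  let ?B = "{d. d \<le> m \<and> \<not> 3 dvd d}"
  have AB: "A \<subseteq> ?B" using A(3) by (auto simp: A_def m_def)
  let ?PA = "\<Union>d\<in>A. prime_polys_deg d :: 'a poly set"
  let ?PB = "\<Union>d\<in>?B. prime_polys_deg d :: 'a poly set"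
  have disj: "\<forall>i\<in>C. \<forall>j\<in>C. i \<noteq> j \<longrightarrow> prime_polys_deg i \<inter> (prime_polys_deg j :: 'a poly set) = {}" for C
    unfolding prime_polys_deg_def by blast
  have fin: "finite ?PA" "finite ?PB" "?PB \<subseteq> prime_polys"
    using A(1) by (auto simp: finite_prime_polys_deg dest: prime_polys_degD)
  have "\<bar>t\<bar> \<le> (\<Sum>d\<in>A. 1 / 4)" using L A(2) by simp
  also have "\<dots> \<le> (\<Sum>d\<in>A. \<Sum>P\<in>prime_polys_deg d. weight \<sigma> P)"
    using A(3) \<sigma>(1) by (intro sum_mono sum_weight_ge) auto
  also have "\<dots> = sum (weight \<sigma>) ?PA"
    using A(1) disj by (subst sum.UNION_disjoint) (auto simp: finite_prime_polys_deg)
  finally have le: "\<bar>t\<bar> \<le> sum (weight \<sigma>) ?PA" .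
  have wt: "0 \<le> weight \<sigma> P \<and> weight \<sigma> P \<le> e" if "P \<in> ?PA" for P
  proof -
    from that obtain d where d: "d \<in> A" "P \<in> prime_polys_deg d" by blast
    show ?thesis using weight_bounds(1,2)[OF d(2) _ \<sigma>(1)] A(3)[OF d(1)] m0[of d] by fastforce
  qed
  obtain G where G: "G \<subseteq> ?PA" "\<bar>sum (weight \<sigma>) G - \<bar>t\<bar>\<bar> \<le> e"
    using subset_sum_approx[OF fin(1) wt _ le] e by auto
  have GB: "G \<subseteq> ?PB" using G(1) AB by blast
  \<comment> \<open>The value 0 switches off every prime of \<open>?PB\<close> outside
    \<open>G\<close>.\<close>
  define s where "s = (\<lambda>P. if P \<in> G then \<sigma> else 0)"
  define w where "w = \<sigma> * sum (weight \<sigma>) G"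
  have "\<bar>w - t\<bar> = \<bar>\<sigma>\<bar> * \<bar>sum (weight \<sigma>) G - \<bar>t\<bar>\<bar>"
    unfolding w_def abs_mult[symmetric] right_diff_distrib \<sigma>(2)[symmetric] ..
  then have wle: "\<bar>w - t\<bar> \<le> e" using G(2) \<sigma>(3) by simp
  have Ww: "W m \<omega> = w" if "\<forall>P\<in>?PB. X P \<omega> = s P" for \<omega>
  proof -
    have "W m \<omega> = (\<Sum>P\<in>?PB. Y P \<omega>)"
      unfolding W_def block_def using disj[of ?B] by (subst sum.UNION_disjoint) (auto simp: finite_prime_polys_deg)
    also have "\<dots> = (\<Sum>P\<in>?PB. coef P * (poly_norm P * s P + (s P)\<^sup>2))"
    proof (rule sum.cong[OF refl])
      fix P assume "P \<in> ?PB"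
      then have "X P \<omega> = s P" using that by blast
      then show "Y P \<omega> = coef P * (poly_norm P * s P + (s P)\<^sup>2)" by (simp add: Y_def)
    qed
    also have "\<dots> = (\<Sum>P\<in>G. \<sigma> * weight \<sigma> P)"
      using fin(2) GB
    proof (rule sum.mono_neutral_cong_right)
      show "\<forall>i\<in>?PB - G. coef i * (poly_norm i * s i + (s i)\<^sup>2) = 0" by (simp add: s_def)
      show "coef P * (poly_norm P * s P + (s P)\<^sup>2) = \<sigma> * weight \<sigma> P" if "P \<in> G" for P
        using that by (simp add: s_def weight_def algebra_simps power2_eq_square)
    qed
    also have "\<dots> = w" by (simp add: w_def sum_distrib_left)
    finally show ?thesis .
  qed
  have "0 < prob {\<omega> \<in> space M. \<forall>P\<in>?PB. X P \<omega> = s P}"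
    using fin \<sigma>(1) by (intro prob_pattern_pos) (auto simp: s_def)
  also have "\<dots> \<le> prob (W m -` {w} \<inter> space M)"
    using Ww by (intro finite_measure_mono measurable_sets[OF W_measurable]) auto
  also have "\<dots> = measure (distr M borel (W m)) {w}" by (simp add: measure_distr)
  finally show ?thesis using wle by (intro exI[of _ m] conjI exI[of _ w]) (auto simp: m_def)
qed

text \<open>If the density vanished at \<open>x\<close>, then by \<open>char_density_atom\<close>
  the density of \<open>Z - W m\<close> would vanish at x - w for every atom w of
  \<open>W m\<close>. Atoms tending to x - y, with \<open>m\<close> tending to infinity, would carry
  these zeros to the density of \<open>Z - W_inf\<close> at a point y where it is nonzero.\<close>

lemma char_density_pos: "char_density (distr M borel Z) x \<in> \<real> \<and> Re (char_density (distr M borel Z) x) > 0"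
proof -
  let ?V = "\<lambda>m. distr M borel (\<lambda>\<omega>. Z \<omega> - W m \<omega>)"
  let ?V' = "distr M borel (\<lambda>\<omega>. Z \<omega> - W_inf \<omega>)"
  obtain K where K: "\<And>u. \<exists>d. 3 dvd d \<and> cmod (char_block d u) \<le> K / (1 + u\<^sup>2)" using cmod_char_block_bound by blast
  interpret DZ: real_distribution "distr M borel Z" by (rule real_distribution_distr) measurable
  have rV: "real_distribution (?V m)" for m by (rule real_distribution_distr) measurable
  have rV': "real_distribution ?V'" by (rule real_distribution_distr) measurable
  have rW: "real_distribution (distr M borel (W m))" for m by (rule real_distribution_distr) measurable
  note intK = integrable_inverse_1_plus_square_lborel[of K]
  have bV: "cmod (char (?V m) u) \<le> K / (1 + u\<^sup>2)" for m u
    using K[of u] char_remainder_bound order_trans by blast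
  have bV': "cmod (char ?V' u) \<le> K / (1 + u\<^sup>2)" for u
    by (rule LIMSEQ_le_const2[OF tendsto_norm[OF char_remainder_limit[of u]]]) (use bV in auto)
  have bZ: "cmod (char (distr M borel Z) u) \<le> K / (1 + u\<^sup>2)" for u
  proof -
    have "cmod (char (distr M borel Z) u) = cmod (char (distr M borel (W 0)) u) * cmod (char (?V 0) u)"
      by (simp add: char_Z_split[where m=0] norm_mult)
    also have "\<dots> \<le> 1 * cmod (char (?V 0) u)"
      by (intro mult_right_mono real_distribution.cmod_char_le_1[OF rW]) simp
    finally show ?thesis using bV[of 0 u] by simp
  qed
  have iV: "integrable lborel (char (?V m))" for m
    by (rule Bochner_Integration.integrable_bound[OF intK])
       (use real_distribution.char_measurable[OF rV] order_trans[OF bV abs_ge_self] in auto)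
  have iV': "integrable lborel (char ?V')"
    by (rule Bochner_Integration.integrable_bound[OF intK])
       (use real_distribution.char_measurable[OF rV'] order_trans[OF bV' abs_ge_self] in auto)
  have iZ: "integrable lborel (char (distr M borel Z))"
    by (rule Bochner_Integration.integrable_bound[OF intK])
       (use DZ.char_measurable order_trans[OF bZ abs_ge_self] in auto)
  have nn: "char_density (distr M borel Z) x \<in> \<real> \<and> Re (char_density (distr M borel Z) x) \<ge> 0"
    by (rule DZ.char_density_nonneg[OF iZ])
  moreover have "Re (char_density (distr M borel Z) x) \<noteq> 0"
  proof
    assume 0: "Re (char_density (distr M borel Z) x) = 0"
    obtain y where y: "char_density ?V' y \<noteq> 0"
      using real_distribution.char_density_nonzero[OF rV' iV'] by blast
    have "\<forall>k. \<exists>m w. m \<ge> k \<and> \<bar>w - (x - y)\<bar> \<le> inverse (real (Suc k)) \<and> measure (distr M borel (W m)) {w} > 0"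
      using ex_atom_W by (metis inverse_positive_iff_positive of_nat_0_less_iff zero_less_Suc)
    then obtain m w where mw: "\<And>k. m k \<ge> k" "\<And>k. \<bar>w k - (x - y)\<bar> \<le> inverse (real (Suc k))"
      "\<And>k. measure (distr M borel (W (m k))) {w k} > 0" by metis
    have zero: "(CLBINT u. exp (- \<i> * complex_of_real ((x - w k) * u)) * char (?V (m k)) u) = 0" for k
      using char_density_atom[OF rW rV iV char_Z_split mw(3), of x k] 0 by (simp add: char_density_def)
    have "(\<lambda>k. w k - (x - y)) \<longlonglongrightarrow> 0"
      by (rule Lim_null_comparison[OF always_eventually LIMSEQ_inverse_real_of_nat]) (use mw(2) in simp)
    from tendsto_diff[OF tendsto_const[of y] this]
    have wlim: "(\<lambda>k. x - w k) \<longlonglongrightarrow> y" by simp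
    have mlim: "filterlim m at_top sequentially"
      using mw(1) by (intro filterlim_at_top_mono[OF filterlim_ident]) auto
    \<comment> \<open>The majorant K / (1 + u^2) involves neither \<open>m k\<close> nor
      \<open>w k\<close>, so the law and the point of evaluation may move together.\<close>
    have "(\<lambda>k. CLBINT u. exp (- \<i> * complex_of_real ((x - w k) * u)) * char (?V (m k)) u)
      \<longlonglongrightarrow> (CLBINT u. exp (- \<i> * complex_of_real (y * u)) * char ?V' u)"
    proof (rule integral_dominated_convergence[OF _ _ intK])
      show "AE u in lborel. (\<lambda>k. exp (- \<i> * complex_of_real ((x - w k) * u)) * char (?V (m k)) u)
          \<longlonglongrightarrow> exp (- \<i> * complex_of_real (y * u)) * char ?V' u"
        by (intro AE_I2 tendsto_intros wlim filterlim_compose[OF char_remainder_limit mlim])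
      show "AE u in lborel. cmod (exp (- \<i> * complex_of_real ((x - w k) * u)) * char (?V (m k)) u) \<le> K / (1 + u\<^sup>2)" for k
        using bV by (intro AE_I2) (simp add: norm_mult)
      show "(\<lambda>u. exp (- \<i> * complex_of_real (y * u)) * char ?V' u) \<in> borel_measurable lborel"
        by (rule borel_measurable_integrable[OF integrable_iexp_mult[OF iV']])
      show "(\<lambda>u. exp (- \<i> * complex_of_real ((x - w k) * u)) * char (?V (m k)) u) \<in> borel_measurable lborel" for k
        by (rule borel_measurable_integrable[OF integrable_iexp_mult[OF iV]])
    qed
    then have "(CLBINT u. exp (- \<i> * complex_of_real (y * u)) * char ?V' u) = 0"
      unfolding zero by (simp add: LIMSEQ_const_iff)
    then show False using y by (simp add: char_density_def)
  qed
  ultimately show ?thesis by linarith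
qed

end

theorem proposition7p3:
  fixes p n q :: nat
    and M :: "'w measure"
    and X :: "'a::{field, finite} poly \<Rightarrow> 'w \<Rightarrow> real"
    and x :: real
  assumes "prime p" and "odd p" and "n \<ge> 1" and "q = p ^ n"
    and "CARD('a) = q"
    and "prob_space M"
    and "prob_space.indep_vars M (\<lambda>_. borel) X prime_polys"
    and "\<And>P. P \<in> prime_polys \<Longrightarrow>
      measure M {\<omega> \<in> space M. X P \<omega> = 1} = poly_norm P / (2 * (poly_norm P + 1))"
    and "\<And>P. P \<in> prime_polys \<Longrightarrow>
      measure M {\<omega> \<in> space M. X P \<omega> = -1} = poly_norm P / (2 * (poly_norm P + 1))"
    and "\<And>P. P \<in> prime_polys \<Longrightarrow>
      measure M {\<omega> \<in> space M. X P \<omega> = 0} = 1 / (poly_norm P + 1)"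
  shows "M_rand M X x \<in> \<real> \<and> Re (M_rand M X x) > 0"
proof -
  have "p \<ge> 3" using \<open>prime p\<close> \<open>odd p\<close> prime_ge_2_nat[of p] by (cases "p = 2") auto
  also have "p \<le> p ^ n" using \<open>n \<ge> 1\<close> \<open>p \<ge> 3\<close> by (intro self_le_power) auto
  finally have "CARD('a) \<ge> 3" using assms(4,5) by simp
  then interpret random_characters M X "real CARD('a)"
    unfolding random_characters_def random_characters_axioms_def
    using assms(6-10) by blast
  show ?thesis
    using char_density_pos[of x] by (simp add: char_density_def M_rand_def Phi_rand_def)
qed

end
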